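(* In the shock model described in the context, fix $t\ge0$. Let $\nu_t$ be the measure on $[0,\infty)$ whose Laplace transform is $$\tilde\nu_t(s)=\exp\left(-\Lambda(t)+\int_0^t q(w)\lambda(w)\tilde\mu(t-w,s)\,dw\right),\quad s\ge0,$$ where $\tilde\mu(u,s)=\iint_{\mathbb{R}_+^2}e^{-uv_1-sv_2}\mu(dv_1,dv_2)$ is the bivariate Laplace transform of $\mu$. Then $$\tilde\phi_t(s)=\tilde F_{G_t}(s)\,\tilde\nu_t(s)\quad\text{for all } s\ge0,$$ equivalently $\phi_t(L)=(F_{G_t}*\nu_t)(L)=\int_{[0,\infty)}F_{G_t}(L-x)\,\nu_t(dx)$ for all $L\ge0$, where $\tilde\phi_t(s)=\int_0^\infty e^{-sL}\phi_t(L)\,dL$ and $\tilde F_{G_t}(s)=\int_0^\infty e^{-sw}F_{G_t}(w)\,dw$. In the special case where $V^{(1)}$ and $V^{(2)}$ are independent, $\tilde\nu_t(s)=e^{-\Lambda(t)+a(t)\tilde\mu_2(s)}$, where $a(t)=\int_0^t\tilde\mu_1(t-w)q(w)\lambda(w)\,dw$ and $\tilde\mu_j(s)=\int_0^\infty e^{-xs}\mu_j(dx)$ is the Laplace transform of the distribution $\mu_j$ of $V^{(j)}$.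
   Context: Shock model. $(N_t)_{t\ge0}$ is a non-homogeneous Poisson process with intensity $\lambda(t)\,dt$ ($\lambda\ge0$), cumulated intensity $\Lambda(t)=\int_0^t\lambda(x)\,dx$, with $\Lambda(t)>0$ for all $t>0$; its points are $0<T_1<T_2<\cdots$. The random vectors $V_i=(V_i^{(1)},V_i^{(2)})$, $i\ge1$, are i.i.d. copies of a non-negative random vector $(V^{(1)},V^{(2)})$ with distribution $\mu$ and marginals $\mu_1,\mu_2$, independent of $(N_t)$. $(G_t)_{t\ge0}$ is a non-decreasing non-negative stochastic process independent of $(N_t)$ and the $V_i$; $F_{G_t}$ is the c.d.f. of $G_t$. $q:[0,\infty)\to[0,1]$. Empty sums are $0$, empty products are $1$. For $L\ge0$ define $$\phi_t(L)=\mathbb{E}\left(F_{G_t}\left(L-\sum_{i=1}^{N_t}V_i^{(2)}\right)e^{-\sum_{i=1}^{N_t}V_i^{(1)}(t-T_i)}\prod_{i=1}^{N_t}q(T_i)\right).$$ *)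

theory Defs
  imports "HOL-Probability.Probability"
begin

definition cum_int :: "(real \<Rightarrow> real) \<Rightarrow> real \<Rightarrow> real" where
  "cum_int lam t = (LINT x:{0..t}|lborel. lam x)"

definition is_nhpp :: "'a measure \<Rightarrow> (real \<Rightarrow> real) \<Rightarrow> (real \<Rightarrow> 'a \<Rightarrow> nat) \<Rightarrow> bool" where
  "is_nhpp M lam N \<longleftrightarrow>
     (\<forall>t\<ge>0. N t \<in> measurable M (count_space UNIV)) \<and>
     (\<forall>\<omega>\<in>space M. N 0 \<omega> = 0
        \<and> (\<forall>s t. 0 \<le> s \<longrightarrow> s \<le> t \<longrightarrow> N s \<omega> \<le> N t \<omega>)
        \<and> (\<forall>t\<ge>0. \<exists>\<delta>>0. \<forall>u. t \<le> u \<and> u < t + \<delta> \<longrightarrow> N u \<omega> = N t \<omega>)) \<and>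
     (\<forall>(n::nat) (ts::nat \<Rightarrow> real). 0 \<le> ts 0 \<and> (\<forall>k<n. ts k < ts (Suc k)) \<longrightarrow>
        prob_space.indep_vars M (\<lambda>_. count_space UNIV)
          (\<lambda>k \<omega>. N (ts (Suc k)) \<omega> - N (ts k) \<omega>) {..<n}) \<and>
     (\<forall>s t (k::nat). 0 \<le> s \<longrightarrow> s \<le> t \<longrightarrow>
        measure M {\<omega>\<in>space M. N t \<omega> - N s \<omega> = k}
          = exp (-(cum_int lam t - cum_int lam s)) * (cum_int lam t - cum_int lam s) ^ k / fact k)"

definition point :: "(real \<Rightarrow> 'a \<Rightarrow> nat) \<Rightarrow> nat \<Rightarrow> 'a \<Rightarrow> real" where
  "point N i \<omega> = Inf {s. 0 \<le> s \<and> i \<le> N s \<omega>}"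

definition gen_events :: "'a measure \<Rightarrow> ('a \<Rightarrow> 'b) \<Rightarrow> 'b measure \<Rightarrow> 'a set set" where
  "gen_events M X M' = {X -` A \<inter> space M | A. A \<in> sets M'}"

definition shock_model :: "'a measure \<Rightarrow> (real \<Rightarrow> real) \<Rightarrow> (real \<Rightarrow> real) \<Rightarrow> (real \<Rightarrow> 'a \<Rightarrow> nat)
    \<Rightarrow> (nat \<Rightarrow> 'a \<Rightarrow> real \<times> real) \<Rightarrow> (real \<times> real) measure \<Rightarrow> (real \<Rightarrow> 'a \<Rightarrow> real) \<Rightarrow> bool" where
  "shock_model M lam q N V \<mu> G \<longleftrightarrow>
     prob_space M \<and>
     (\<forall>x. 0 \<le> lam x) \<and>
     (\<forall>t\<ge>0. set_integrable lborel {0..t} lam) \<and>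
     (\<forall>t>0. 0 < cum_int lam t) \<and>
     is_nhpp M lam N \<and>
     (\<forall>i\<ge>1. V i \<in> borel_measurable M \<and> distr M borel (V i) = \<mu>) \<and>
     (\<forall>i\<ge>1. AE \<omega> in M. 0 \<le> fst (V i \<omega>) \<and> 0 \<le> snd (V i \<omega>)) \<and>
     prob_space.indep_vars M (\<lambda>_. borel) V {1..} \<and>
     (\<forall>t\<ge>0. G t \<in> borel_measurable M) \<and>
     (\<forall>\<omega>\<in>space M. (\<forall>t\<ge>0. 0 \<le> G t \<omega>) \<and> (\<forall>s t. 0 \<le> s \<longrightarrow> s \<le> t \<longrightarrow> G s \<omega> \<le> G t \<omega>)) \<and>
     (\<lambda>\<omega>. restrict (\<lambda>t. N t \<omega>) {0..}) \<in> measurable M (PiM {0..} (\<lambda>_. count_space UNIV)) \<and>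
     (\<lambda>\<omega>. restrict (\<lambda>i. V i \<omega>) {1..}) \<in> measurable M (PiM {1..} (\<lambda>_. borel)) \<and>
     (\<lambda>\<omega>. restrict (\<lambda>t. G t \<omega>) {0..}) \<in> measurable M (PiM {0..} (\<lambda>_. borel)) \<and>
     prob_space.indep_sets M
       (\<lambda>j::nat. if j = 0 then gen_events M (\<lambda>\<omega>. restrict (\<lambda>t. N t \<omega>) {0..}) (PiM {0..} (\<lambda>_. count_space UNIV))
          else if j = 1 then gen_events M (\<lambda>\<omega>. restrict (\<lambda>i. V i \<omega>) {1..}) (PiM {1..} (\<lambda>_. borel))
          else gen_events M (\<lambda>\<omega>. restrict (\<lambda>t. G t \<omega>) {0..}) (PiM {0..} (\<lambda>_. borel))) {0, 1, 2} \<and>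
     (\<forall>x\<ge>0. 0 \<le> q x \<and> q x \<le> 1) \<and>
     set_borel_measurable borel {0..} q"

definition cdfG :: "'a measure \<Rightarrow> (real \<Rightarrow> 'a \<Rightarrow> real) \<Rightarrow> real \<Rightarrow> real \<Rightarrow> real" where
  "cdfG M G t = cdf (distr M borel (G t))"

definition shock_phi :: "'a measure \<Rightarrow> (real \<Rightarrow> real) \<Rightarrow> (real \<Rightarrow> 'a \<Rightarrow> nat)
    \<Rightarrow> (nat \<Rightarrow> 'a \<Rightarrow> real \<times> real) \<Rightarrow> (real \<Rightarrow> 'a \<Rightarrow> real) \<Rightarrow> real \<Rightarrow> real \<Rightarrow> real" where
  "shock_phi M q N V G t L =
     (\<integral>\<omega>. cdfG M G t (L - (\<Sum>i\<in>{1..N t \<omega>}. snd (V i \<omega>)))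
          * exp (- (\<Sum>i\<in>{1..N t \<omega>}. fst (V i \<omega>) * (t - point N i \<omega>)))
          * (\<Prod>i\<in>{1..N t \<omega>}. q (point N i \<omega>)) \<partial>M)"

text \<open>Laplace transform int_0^oo e^{-sx} f(x) dx of a non-negative function (in [0,oo]).\<close>
definition laplace_fun :: "(real \<Rightarrow> real) \<Rightarrow> real \<Rightarrow> ennreal" where
  "laplace_fun f s = (\<integral>\<^sup>+ x\<in>{0..}. ennreal (exp (- s * x) * f x) \<partial>lborel)"

definition laplace_meas :: "real measure \<Rightarrow> real \<Rightarrow> real" where
  "laplace_meas \<nu> s = (\<integral>x. exp (- x * s) \<partial>\<nu>)"

definition laplace2 :: "(real \<times> real) measure \<Rightarrow> real \<Rightarrow> real \<Rightarrow> real" where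
  "laplace2 \<mu> u s = (\<integral>v. exp (- u * fst v - s * snd v) \<partial>\<mu>)"

definition is_nu :: "(real \<Rightarrow> real) \<Rightarrow> (real \<Rightarrow> real) \<Rightarrow> (real \<times> real) measure \<Rightarrow> real \<Rightarrow> real measure \<Rightarrow> bool" where
  "is_nu lam q \<mu> t \<nu> \<longleftrightarrow>
     sets \<nu> = sets borel \<and> finite_measure \<nu> \<and> emeasure \<nu> {..<0} = 0 \<and>
     (\<forall>s\<ge>0. laplace_meas \<nu> s
        = exp (- cum_int lam t + (LINT w:{0..t}|lborel. q w * lam w * laplace2 \<mu> (t - w) s)))"

end

theory Submission
  imports Defs
begin

text \<open>
  Let \<open>W\<close> be the discount factor and \<open>S\<close> the accumulated second marks in the definition of \<open>\<phi>\<^sub>t\<close>, so that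
  \<open>\<phi>\<^sub>t(L) = E(F(L - S) W)\<close>. This is the convolution of \<open>F\<close> with the law of \<open>S\<close> under the measure of density \<open>W\<close>,
  whose Laplace transform is \<open>E(\<Prod>\<^sub>i q(T\<^sub>i) exp(-X\<^sub>i (t - T\<^sub>i) - s Y\<^sub>i))\<close>, where \<open>V\<^sub>i = (X\<^sub>i, Y\<^sub>i)\<close>. Integrating out the
  marks leaves \<open>E(\<Prod>\<^sub>i h(T\<^sub>i))\<close> with \<open>h(w) = q(w) E(exp(-X\<^sub>1 (t - w) - s Y\<^sub>1))\<close>, which the probability generating
  functional of the Poisson process evaluates to \<open>exp(-\<integral>(1 - h) \<lambda>)\<close>. Injectivity of the Laplace
  transform (Stone-Weierstrass in the variable \<open>exp(-x)\<close>) identifies this law with \<open>\<nu>\<^sub>t\<close>.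
\<close>

section \<open>Laplace transforms of finite measures on the half-line\<close>

text \<open>The process enters only through its counts, so the generating functional is built from
  independent Poisson increments: it holds for functions constant on grid cells, and dominated
  convergence extends it to continuous \<open>h\<close>. The obstacle is the last extension, since
  \<open>q\<close>, and with it \<open>h\<close>, is merely Borel. The identity is not linear in
  \<open>h\<close>, so a monotone class argument does not apply directly, and approximation by
  continuous functions converges only almost everywhere. The exceptional null set is harmless in the
  intensity integral, but along the random points it is harmless only if these avoid it. That fact
  comes from the functional itself: the indicator of a closed set is an everywhere limit of
  continuous functions, so void probabilities of open sets are available beforehand and there is no
  circle. The theorem quantifies over every measure with the given transform, which is why both an
  explicit witness, \<open>shock_measure\<close>, and uniqueness are required.\<close>

lemma emeasure_lessThan_0_AE_nonneg:
  fixes \<mu> :: "real measure"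
  assumes "sets \<mu> = sets borel" "emeasure \<mu> {..<0} = 0"
  shows "AE x in \<mu>. 0 \<le> x"
proof -
  have "{..<0} \<in> null_sets \<mu>" using assms by (auto simp: null_sets_def)
  then show ?thesis by (rule AE_I') (auto simp: not_le)
qed

text \<open>Natural arguments suffice: under y = exp(-x) they are the moments of a measure on the
  compact interval [0,1]. Polynomials in y are uniformly dense there, so the integrals of all
  continuous functions of exp(-x) agree.\<close>

lemma laplace_transform_unique:
  fixes \<mu> \<nu> :: "real measure"
  assumes sets: "sets \<mu> = sets borel" "sets \<nu> = sets borel"
    and fin: "finite_measure \<mu>" "finite_measure \<nu>"
    and nonneg: "emeasure \<mu> {..<0} = 0" "emeasure \<nu> {..<0} = 0"
    and eq: "\<And>n::nat. (\<integral>x. exp (- x * real n) \<partial>\<mu>) = (\<integral>x. exp (- x * real n) \<partial>\<nu>)"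
  shows "\<mu> = \<nu>"
proof -
  interpret mu: finite_measure \<mu> by fact
  interpret nu: finite_measure \<nu> by fact
  note [measurable_cong] = sets
  have ae: "AE x in \<mu>. 0 \<le> x" "AE x in \<nu>. 0 \<le> x"
    using emeasure_lessThan_0_AE_nonneg sets nonneg by blast+
  have sp: "space \<mu> = UNIV" "space \<nu> = UNIV"
    using sets_eq_imp_space_eq[OF sets(1)] sets_eq_imp_space_eq[OF sets(2)] by auto
  have int: "integrable \<mu> (\<lambda>x. f (exp (- x)))" "integrable \<nu> (\<lambda>x. f (exp (- x)))"
    if f: "f \<in> borel_measurable borel" "\<And>y. y \<in> {0..1} \<Longrightarrow> \<bar>f y\<bar> \<le> B" for f :: "real \<Rightarrow> real" and B
  proof -
    note [measurable] = f(1)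
    show "integrable \<mu> (\<lambda>x. f (exp (- x)))"
      using ae(1) f(2) by (intro mu.integrable_const_bound[where B=B]) auto
    show "integrable \<nu> (\<lambda>x. f (exp (- x)))"
      using ae(2) f(2) by (intro nu.integrable_const_bound[where B=B]) auto
  qed
  have poly: "(\<integral>x. g (exp (- x)) \<partial>\<mu>) = (\<integral>x. g (exp (- x)) \<partial>\<nu>)" if g: "real_polynomial_function g" for g
  proof -
    obtain a n where g: "g = (\<lambda>x. \<Sum>i\<le>n. a i * x ^ i)"
      using g unfolding real_polynomial_function_iff_sum by auto
    have p: "exp (- x) ^ i = exp (- x * real i)" for x :: real and i
      by (simp add: exp_of_nat_mult[symmetric] mult.commute)
    have "integrable \<mu> (\<lambda>x. a i * exp (- x) ^ i)" "integrable \<nu> (\<lambda>x. a i * exp (- x) ^ i)" for i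
      by (intro integrable_mult_right int[where f="\<lambda>y. y ^ i" and B=1]; auto simp: power_le_one)+
    then show ?thesis
      unfolding g by (simp add: Bochner_Integration.integral_sum p eq[simplified])
  qed
  have cont: "(\<integral>x. f (exp (- x)) \<partial>\<mu>) = (\<integral>x. f (exp (- x)) \<partial>\<nu>)" if f: "continuous_on UNIV f" for f :: "real \<Rightarrow> real"
  proof -
    have fm: "f \<in> borel_measurable borel" using f by (rule borel_measurable_continuous_onI)
    have "compact (f ` {0..1})"
      using f by (intro compact_continuous_image) (auto intro: continuous_on_subset)
    then have "bounded (f ` {0..1})" by (rule compact_imp_bounded)
    then obtain B where B: "\<And>y. y \<in> {0..1} \<Longrightarrow> \<bar>f y\<bar> \<le> B"
      unfolding bounded_iff by (metis imageI real_norm_def)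
    have le: "\<bar>(\<integral>x. f (exp (- x)) \<partial>\<mu>) - (\<integral>x. f (exp (- x)) \<partial>\<nu>)\<bar>
        \<le> e * (measure \<mu> UNIV + measure \<nu> UNIV)" if e: "e > 0" for e
    proof -
      obtain g where g: "real_polynomial_function g" "\<And>x. x \<in> {0..1} \<Longrightarrow> \<bar>f x - g x\<bar> < e"
        using Stone_Weierstrass_real_polynomial_function[of "{0..1::real}" f e] f e
        by (auto intro: continuous_on_subset)
      have gm: "g \<in> borel_measurable borel"
        using g(1) by (intro borel_measurable_continuous_onI continuous_on_polymonial_function)
           (simp add: real_polynomial_function_eq)
      have gB: "\<bar>g y\<bar> \<le> B + e" if "y \<in> {0..1}" for y using g(2)[OF that] B[OF that] by linarith
      have 1: "\<bar>(\<integral>x. f (exp (- x)) \<partial>M) - (\<integral>x. g (exp (- x)) \<partial>M)\<bar> \<le> e * measure M UNIV"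
        if M: "finite_measure M" "space M = UNIV" "AE x in M. 0 \<le> x" "integrable M (\<lambda>x. f (exp (- x)))" "integrable M (\<lambda>x. g (exp (- x)))"
        for M :: "real measure"
      proof -
        interpret finite_measure M by fact
        have "\<bar>(\<integral>x. f (exp (- x)) \<partial>M) - (\<integral>x. g (exp (- x)) \<partial>M)\<bar> = \<bar>\<integral>x. f (exp (- x)) - g (exp (- x)) \<partial>M\<bar>"
          using M by simp
        also have "\<dots> \<le> (\<integral>x. \<bar>f (exp (- x)) - g (exp (- x))\<bar> \<partial>M)"
          by (rule integral_abs_bound)
        also have "\<dots> \<le> (\<integral>x. e \<partial>M)"
        proof (rule integral_mono_AE)
          show "AE x in M. \<bar>f (exp (- x)) - g (exp (- x))\<bar> \<le> e"
            using M(3)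
          proof eventually_elim
            case (elim x)
            then show ?case using g(2)[of "exp (- x)"] by simp
          qed
        qed (use M in auto)
        finally show ?thesis using M(2) by (simp add: mult.commute)
      qed
      show ?thesis
        using 1[OF fin(1) sp(1) ae(1) int(1)[OF fm B] int(1)[OF gm gB]]
          1[OF fin(2) sp(2) ae(2) int(2)[OF fm B] int(2)[OF gm gB]] poly[OF g(1)]
        by (simp add: algebra_simps abs_if split: if_splits)
    qed
    \<comment> \<open>The added 1 keeps the divisor positive even if both measures vanish.\<close>
    define K where "K = measure \<mu> UNIV + measure \<nu> UNIV + 1"
    have K: "K > 0" unfolding K_def by (simp add: add_nonneg_pos)
    have "\<bar>(\<integral>x. f (exp (- x)) \<partial>\<mu>) - (\<integral>x. f (exp (- x)) \<partial>\<nu>)\<bar> \<le> 0 + e" if "e > 0" for e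
    proof -
      have "e / K * (K - 1) \<le> e" using K that by (simp add: field_simps)
      then show ?thesis using le[of "e / K"] K that unfolding K_def by simp
    qed
    from field_le_epsilon[OF this] show ?thesis by simp
  qed
  show ?thesis
  proof (rule measure_eqI_lessThan[OF sets])
    fix a :: real
    show "emeasure \<mu> {a<..} < \<infinity>" by (simp add: mu.emeasure_eq_measure)
    \<comment> \<open>A continuous ramp in y = exp(-x): it is 0 for y >= exp(-a) and steepens with
      \<open>n\<close>, so it tends to the indicator of y < exp(-a), that is, of x > a.\<close>
    define f where "f n y = min 1 (max 0 (real n * (exp (- a) - y)))" for n y
    have lim: "(\<lambda>n. f n (exp (- x))) \<longlonglongrightarrow> indicator {a<..} x" for x
    proof (cases "x > a")
      case True
      then have p: "exp (- a) - exp (- x) > 0" by simp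
      obtain n0 :: nat where n0: "1 / (exp (- a) - exp (- x)) < n0" using reals_Archimedean2 by blast
      have "eventually (\<lambda>n. f n (exp (- x)) = 1) sequentially"
        using eventually_ge_at_top[of n0]
      proof eventually_elim
        case (elim n)
        then have "1 / (exp (- a) - exp (- x)) < n" using n0 by linarith
        then have "1 < n * (exp (- a) - exp (- x))" using p by (simp add: field_simps)
        then show ?case unfolding f_def by simp
      qed
      then show ?thesis using True by (simp add: tendsto_eventually)
    next
      case False
      then have "exp (- a) - exp (- x) \<le> 0" by simp
      then have "real n * (exp (- a) - exp (- x)) \<le> 0" for n
        by (simp add: mult_nonneg_nonpos)
      then have "f n (exp (- x)) = 0" for n unfolding f_def by simp
      then show ?thesis using False by simp
    qed
    have [measurable]: "f n \<in> borel_measurable borel" for n unfolding f_def by measurable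
    have fb: "norm (f n y) \<le> 1" for n y unfolding f_def by auto
    have "(\<lambda>n. \<integral>x. f n (exp (- x)) \<partial>\<mu>) \<longlonglongrightarrow> (\<integral>x. indicator {a<..} x \<partial>\<mu>)"
      by (rule integral_dominated_convergence[where w="\<lambda>_. 1"]) (use lim fb in auto)
    moreover have "(\<lambda>n. \<integral>x. f n (exp (- x)) \<partial>\<nu>) \<longlonglongrightarrow> (\<integral>x. indicator {a<..} x \<partial>\<nu>)"
      by (rule integral_dominated_convergence[where w="\<lambda>_. 1"]) (use lim fb in auto)
    moreover have "(\<integral>x. f n (exp (- x)) \<partial>\<mu>) = (\<integral>x. f n (exp (- x)) \<partial>\<nu>)" for n
      by (rule cont) (auto simp: f_def intro!: continuous_intros)
    ultimately have "(\<integral>x. indicator {a<..} x \<partial>\<mu>) = (\<integral>x. indicator {a<..} x \<partial>\<nu> :: real)"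
      using LIMSEQ_unique by auto
    then show "emeasure \<mu> {a<..} = emeasure \<nu> {a<..}"
      by (simp add: mu.emeasure_eq_measure nu.emeasure_eq_measure sp)
  qed
qed

text \<open>Tonelli and translation invariance. Working in \<open>ennreal\<close> also covers s = 0,
  where the transform of a distribution function is infinite.\<close>

lemma laplace_fun_convolution:
  fixes F :: "real \<Rightarrow> real" and \<nu> :: "real measure"
  assumes \<nu>: "sets \<nu> = sets borel" "finite_measure \<nu>" "emeasure \<nu> {..<0} = 0"
    and F[measurable]: "F \<in> borel_measurable borel" and F01: "\<And>x. 0 \<le> F x" "\<And>x. F x \<le> 1"
    and F0: "\<And>x. x < 0 \<Longrightarrow> F x = 0"
    and s: "0 \<le> s"
  shows "laplace_fun (\<lambda>L. \<integral>x. F (L - x) \<partial>\<nu>) s = laplace_fun F s * ennreal (laplace_meas \<nu> s)"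
proof -
  interpret finite_measure \<nu> by fact
  interpret P: pair_sigma_finite lborel \<nu> ..
  note [measurable_cong] = \<nu>(1)
  have ae: "AE x in \<nu>. 0 \<le> x" using emeasure_lessThan_0_AE_nonneg \<nu> by blast
  let ?f = "\<lambda>x L. ennreal (exp (- s * L) * F (L - x)) * indicator {0..} L"
  have "laplace_fun (\<lambda>L. \<integral>x. F (L - x) \<partial>\<nu>) s = (\<integral>\<^sup>+L. \<integral>\<^sup>+x. ?f x L \<partial>\<nu> \<partial>lborel)"
    unfolding laplace_fun_def
  proof (rule nn_integral_cong)
    fix L :: real
    have i: "integrable \<nu> (\<lambda>x. F (L - x))"
      using F01 by (intro integrable_const_bound[where B=1]) auto
    have "ennreal (exp (- s * L) * (\<integral>x. F (L - x) \<partial>\<nu>)) = (\<integral>\<^sup>+x. ennreal (exp (- s * L) * F (L - x)) \<partial>\<nu>)"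
      using i F01 by (subst nn_integral_eq_integral) auto
    then show "ennreal (exp (- s * L) * (\<integral>x. F (L - x) \<partial>\<nu>)) * indicator {0..} L = (\<integral>\<^sup>+x. ?f x L \<partial>\<nu>)"
      by (simp add: nn_integral_multc)
  qed
  also have "\<dots> = (\<integral>\<^sup>+x. \<integral>\<^sup>+L. ?f x L \<partial>lborel \<partial>\<nu>)"
    by (rule P.Fubini'[symmetric]) measurable
  also have "\<dots> = (\<integral>\<^sup>+x. laplace_fun F s * ennreal (exp (- x * s)) \<partial>\<nu>)"
  proof (rule nn_integral_cong_AE, use ae in eventually_elim)
    case (elim x)
    \<comment> \<open>Substitution L = x + u. The range becomes u >= -x; since \<open>F\<close>
      vanishes on negative arguments and x >= 0, it may be cut down to u >= 0.\<close>
    have "(\<integral>\<^sup>+L. ?f x L \<partial>lborel) = (\<integral>\<^sup>+u. ?f x (x + 1 * u) \<partial>lborel)"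
      by (subst nn_integral_real_affine[where c=1 and t=x]) auto
    also have "\<dots> = (\<integral>\<^sup>+u. ennreal (exp (- s * u) * F u) * indicator {0..} u * ennreal (exp (- x * s)) \<partial>lborel)"
    proof (rule nn_integral_cong)
      fix u :: real
      have "exp (- s * (x + u)) = exp (- s * u) * exp (- x * s)" by (simp add: exp_add[symmetric] algebra_simps)
      then show "?f x (x + 1 * u) = ennreal (exp (- s * u) * F u) * indicator {0..} u * ennreal (exp (- x * s))"
        using elim F01 F0[of u] by (auto simp: ennreal_mult[symmetric] mult_ac split: split_indicator)
    qed
    also have "\<dots> = laplace_fun F s * ennreal (exp (- x * s))"
      unfolding laplace_fun_def by (rule nn_integral_multc) measurable
    finally show ?case .
  qed
  also have "\<dots> = laplace_fun F s * (\<integral>\<^sup>+x. ennreal (exp (- x * s)) \<partial>\<nu>)"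
    by (rule nn_integral_cmult) measurable
  also have "(\<integral>\<^sup>+x. ennreal (exp (- x * s)) \<partial>\<nu>) = ennreal (laplace_meas \<nu> s)"
    unfolding laplace_meas_def using ae s
    by (intro nn_integral_eq_integral integrable_const_bound[where B=1]) (auto elim!: eventually_mono)
  finally show ?thesis .
qed

section \<open>The probability generating functional of a Poisson process\<close>

text \<open>Rounding goes up because an increment of the counting process counts the points of a
  cell that is open on the left and closed on the right; all of them are sent to the right
  endpoint.\<close>

definition grid_ceiling :: "real \<Rightarrow> nat \<Rightarrow> real \<Rightarrow> real" where
  "grid_ceiling t n x = t * of_int \<lceil>real n * x / t\<rceil> / real n"

lemma grid_ceiling_eq:
  assumes "0 < t" "0 < n" "t * real m / real n < x" "x \<le> t * real (Suc m) / real n"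
  shows "grid_ceiling t n x = t * real (Suc m) / real n"
proof -
  have "\<lceil>real n * x / t\<rceil> = int (Suc m)"
    using assms by (intro ceiling_unique) (auto simp: field_simps)
  then show ?thesis unfolding grid_ceiling_def by simp
qed

lemma grid_ceiling_tendsto:
  assumes "0 < t"
  shows "(\<lambda>n. grid_ceiling t (Suc n) x) \<longlonglongrightarrow> x"
proof (rule real_tendsto_sandwich)
  show "\<forall>\<^sub>F n in sequentially. x \<le> grid_ceiling t (Suc n) x"
  proof (rule always_eventually, rule allI)
    fix n
    have "real (Suc n) * x / t \<le> of_int \<lceil>real (Suc n) * x / t\<rceil>" by (rule le_of_int_ceiling)
    then have "t * (real (Suc n) * x / t) / real (Suc n) \<le> grid_ceiling t (Suc n) x"
      using assms unfolding grid_ceiling_def by (intro divide_right_mono mult_left_mono) auto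
    then show "x \<le> grid_ceiling t (Suc n) x" using assms by simp
  qed
  show "\<forall>\<^sub>F n in sequentially. grid_ceiling t (Suc n) x \<le> x + t / real (Suc n)"
  proof (rule always_eventually, rule allI)
    fix n
    have "of_int \<lceil>real (Suc n) * x / t\<rceil> \<le> real (Suc n) * x / t + 1" by (rule of_int_ceiling_le_add_one)
    then have "t * of_int \<lceil>real (Suc n) * x / t\<rceil> \<le> t * (real (Suc n) * x / t + 1)"
      using assms by (intro mult_left_mono) auto
    then have "grid_ceiling t (Suc n) x \<le> t * (real (Suc n) * x / t + 1) / real (Suc n)"
      unfolding grid_ceiling_def by (intro divide_right_mono) auto
    also have "\<dots> = x + t / real (Suc n)" using assms by (simp add: field_simps del: of_nat_Suc)
    finally show "grid_ceiling t (Suc n) x \<le> x + t / real (Suc n)" .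
  qed
  have "(\<lambda>n. x + t * inverse (real (Suc n))) \<longlonglongrightarrow> x + t * 0"
    by (intro tendsto_intros LIMSEQ_inverse_real_of_nat)
  then show "(\<lambda>n. x + t / real (Suc n)) \<longlonglongrightarrow> x" by (simp add: divide_inverse)
qed simp

section \<open>The counting process and its arrival times\<close>

locale nhpp = prob_space M for M :: "'a measure" +
  fixes lam :: "real \<Rightarrow> real" and N :: "real \<Rightarrow> 'a \<Rightarrow> nat"
  assumes lam_nonneg: "\<And>x. 0 \<le> lam x"
    and lam_integrable: "\<And>t. 0 \<le> t \<Longrightarrow> set_integrable lborel {0..t} lam"
    and nhpp: "is_nhpp M lam N"
begin

lemma N_measurable: "0 \<le> t \<Longrightarrow> N t \<in> measurable M (count_space UNIV)"
  using nhpp unfolding is_nhpp_def by blast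

lemma N_0: "\<omega> \<in> space M \<Longrightarrow> N 0 \<omega> = 0"
  using nhpp unfolding is_nhpp_def by blast

lemma N_mono: "\<omega> \<in> space M \<Longrightarrow> 0 \<le> s \<Longrightarrow> s \<le> t \<Longrightarrow> N s \<omega> \<le> N t \<omega>"
  using nhpp unfolding is_nhpp_def by blast

lemma N_right_continuous:
  "\<omega> \<in> space M \<Longrightarrow> 0 \<le> t \<Longrightarrow> \<exists>\<delta>>0. \<forall>u. t \<le> u \<and> u < t + \<delta> \<longrightarrow> N u \<omega> = N t \<omega>"
  using nhpp unfolding is_nhpp_def by blast

lemma N_indep_increments:
  "0 \<le> ts 0 \<Longrightarrow> (\<And>k. k < n \<Longrightarrow> ts k < ts (Suc k)) \<Longrightarrow>
    indep_vars (\<lambda>_. count_space UNIV) (\<lambda>k \<omega>. N (ts (Suc k)) \<omega> - N (ts k) \<omega>) {..<n}"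
  using nhpp unfolding is_nhpp_def by blast

lemma N_increment_poisson:
  "0 \<le> s \<Longrightarrow> s \<le> t \<Longrightarrow> prob {\<omega>\<in>space M. N t \<omega> - N s \<omega> = k}
     = exp (-(cum_int lam t - cum_int lam s)) * (cum_int lam t - cum_int lam s) ^ k / fact k"
  using nhpp unfolding is_nhpp_def by blast

text \<open>Right-continuity makes the infimum in \<open>point\<close> attained: if fewer than
  \<open>i\<close> shocks have occurred by \<open>s\<close>, this remains so for a positive time
  after \<open>s\<close>. The bound at \<open>u\<close> guarantees that the infimum is over a
  nonempty set.\<close>

lemma point_le_iff:
  assumes "\<omega> \<in> space M" "0 \<le> s" "0 \<le> u" "i \<le> N u \<omega>"
  shows "point N i \<omega> \<le> s \<longleftrightarrow> i \<le> N s \<omega>"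
proof
  assume "i \<le> N s \<omega>"
  then show "point N i \<omega> \<le> s" unfolding point_def
    using assms by (intro cInf_lower bdd_belowI[of _ 0]) auto
next
  assume le: "point N i \<omega> \<le> s"
  show "i \<le> N s \<omega>"
  proof (rule ccontr)
    assume n: "\<not> i \<le> N s \<omega>"
    obtain d where d: "d > 0" "\<And>v. s \<le> v \<Longrightarrow> v < s + d \<Longrightarrow> N v \<omega> = N s \<omega>"
      using N_right_continuous[OF assms(1,2)] by blast
    have "s + d \<le> point N i \<omega>" unfolding point_def
    proof (rule cInf_greatest)
      show "{s. 0 \<le> s \<and> i \<le> N s \<omega>} \<noteq> {}" using assms by auto
      fix v assume v: "v \<in> {s. 0 \<le> s \<and> i \<le> N s \<omega>}"
      show "s + d \<le> v"
      proof (rule ccontr)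
        assume "\<not> s + d \<le> v"
        then have "N v \<omega> \<le> N s \<omega>"
          using d(2)[of v] N_mono[OF assms(1), of v s] v by (cases "s \<le> v") auto
        then show False using n v by auto
      qed
    qed
    then show False using le d(1) by linarith
  qed
qed

lemma point_pos:
  assumes "\<omega> \<in> space M" "0 \<le> u" "1 \<le> i" "i \<le> N u \<omega>"
  shows "0 < point N i \<omega>"
  using point_le_iff[OF assms(1) order_refl assms(2,4)] N_0[OF assms(1)] assms(3) by linarith

lemma point_le:
  assumes "\<omega> \<in> space M" "0 \<le> u" "i \<le> N u \<omega>"
  shows "point N i \<omega> \<le> u"
  using point_le_iff[OF assms(1,2,2,3)] assms(3) by blast

text \<open>The sigma-algebra \<open>B\<close> is left open so that the lemma applies both to
  \<open>M\<close> and to the sigma-algebra generated by the path of \<open>N\<close>, which is the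
  one known to be independent of the marks.\<close>

lemma point_measurable:
  assumes B: "space B = space M" "\<And>s. 0 \<le> s \<Longrightarrow> N s \<in> measurable B (count_space UNIV)"
    and t: "0 \<le> t"
  shows "(\<lambda>\<omega>. if i \<in> {1..N t \<omega>} then point N i \<omega> else 0) \<in> borel_measurable B"
proof (rule borel_measurableI_le)
  fix s :: real
  show "{\<omega> \<in> space B. (if i \<in> {1..N t \<omega>} then point N i \<omega> else 0) \<le> s} \<in> sets B"
  proof (cases "0 \<le> s")
    case True
    \<comment> \<open>Either the default value 0 is in force, or the event is
      \<open>i \<le> N s \<omega>\<close>; both are conditions on counts alone.\<close>
    have "{\<omega> \<in> space B. (if i \<in> {1..N t \<omega>} then point N i \<omega> else 0) \<le> s}
      = (N t -` {j. i \<in> {1..j} \<longrightarrow> False} \<inter> space B) \<union> (N s -` {i..} \<inter> space B)"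
      using point_le_iff[OF _ True t, of _ i] True B(1) N_mono[OF _ True, of _ t] point_le[OF _ t, of _ i]
      by (auto split: if_splits)
    also have "\<dots> \<in> sets B"
      by (intro sets.Un measurable_sets[OF B(2)[OF t]] measurable_sets[OF B(2)[OF True]]) auto
    finally show ?thesis .
  next
    case False
    have neg: "\<not> (if i \<in> {1..N t \<omega>} then point N i \<omega> else 0) \<le> s" if "\<omega> \<in> space B" for \<omega>
    proof (cases "i \<in> {1..N t \<omega>}")
      case True
      then have "0 < point N i \<omega>" using point_pos[OF _ t, of \<omega> i] B(1) that by simp
      then show ?thesis using True \<open>\<not> 0 \<le> s\<close> by simp
    next
      case False
      then show ?thesis using \<open>\<not> 0 \<le> s\<close> by (simp only: if_False simp_thms)
    qed
    have "{\<omega> \<in> space B. (if i \<in> {1..N t \<omega>} then point N i \<omega> else 0) \<le> s} = {}"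
      using neg by blast
    then show ?thesis by (simp only: sets.empty_sets)
  qed
qed

text \<open>The number of factors is random but takes countably many values, so measurability is
  checked for each fixed number. Clipping the arrival times makes each of them measurable and
  changes no factor of the product.\<close>

lemma prod_points_measurable:
  fixes h :: "real \<Rightarrow> real"
  assumes t: "0 \<le> t" and h[measurable]: "h \<in> borel_measurable borel"
  shows "(\<lambda>\<omega>. \<Prod>i\<in>{1..N t \<omega>}. h (point N i \<omega>)) \<in> borel_measurable M"
proof -
  note [measurable] = N_measurable[OF t] point_measurable[OF refl N_measurable t]
  have "(\<lambda>\<omega>. \<Prod>i\<in>{1..N t \<omega>}. h (if i \<in> {1..N t \<omega>} then point N i \<omega> else 0)) \<in> borel_measurable M"
    by (rule measurable_compose_countable[where g="N t"]) measurable
  also have "(\<lambda>\<omega>. \<Prod>i\<in>{1..N t \<omega>}. h (if i \<in> {1..N t \<omega>} then point N i \<omega> else 0))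
      = (\<lambda>\<omega>. \<Prod>i\<in>{1..N t \<omega>}. h (point N i \<omega>))"
    by (intro ext prod.cong) auto
  finally show ?thesis .
qed

section \<open>Cumulated intensity and Poisson increments\<close>

lemma cum_int_diff:
  assumes "0 \<le> s" "s \<le> t"
  shows "cum_int lam t - cum_int lam s = (LINT x:{s<..t}|lborel. lam x)"
proof -
  have "{0..t} = {0..s} \<union> {s<..t}" using assms by auto
  moreover have "(LINT x:({0..s} \<union> {s<..t})|lborel. lam x) = (LINT x:{0..s}|lborel. lam x) + (LINT x:{s<..t}|lborel. lam x)"
    using assms by (intro set_integral_Un set_integrable_subset[OF lam_integrable[of t]]) auto
  ultimately show ?thesis unfolding cum_int_def by simp
qed

lemma cum_int_mono: "0 \<le> s \<Longrightarrow> s \<le> t \<Longrightarrow> cum_int lam s \<le> cum_int lam t"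
proof -
  assume st: "0 \<le> s" "s \<le> t"
  have "0 \<le> (LINT x:{s<..t}|lborel. lam x)"
    unfolding set_lebesgue_integral_def by (intro integral_nonneg_AE) (simp add: lam_nonneg)
  then show ?thesis using cum_int_diff[OF st] by simp
qed

text \<open>The law of the increment is identified atom by atom as Poisson; the generating function
  is then an exponential series.\<close>

lemma increment_pgf:
  assumes st: "0 \<le> s" "s \<le> t" and c: "0 \<le> c" "c \<le> (1::real)"
  shows "(\<integral>\<omega>. c ^ (N t \<omega> - N s \<omega>) \<partial>M) = exp (-((1 - c) * (cum_int lam t - cum_int lam s)))"
proof -
  let ?m = "cum_int lam t - cum_int lam s"
  note [measurable] = N_measurable[OF st(1)] N_measurable[of t]
  have t: "0 \<le> t" using st by simp
  have m: "0 \<le> ?m" using cum_int_mono[OF st] by simp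
  have X[measurable]: "(\<lambda>\<omega>. N t \<omega> - N s \<omega>) \<in> measurable M (count_space UNIV)"
    using t by measurable
  have "(\<integral>\<^sup>+\<omega>. ennreal (c ^ (N t \<omega> - N s \<omega>)) \<partial>M)
      = (\<integral>\<^sup>+k. ennreal (c ^ k) \<partial>distr M (count_space UNIV) (\<lambda>\<omega>. N t \<omega> - N s \<omega>))"
    by (subst nn_integral_distr[OF X]) auto
  also have "distr M (count_space UNIV) (\<lambda>\<omega>. N t \<omega> - N s \<omega>)
      = density (count_space UNIV) (\<lambda>k. ennreal (exp (- ?m) * ?m ^ k / fact k))"
  proof (rule measure_eqI_countable[where A=UNIV])
    fix k :: nat
    have "emeasure (distr M (count_space UNIV) (\<lambda>\<omega>. N t \<omega> - N s \<omega>)) {k}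
        = emeasure M {\<omega>\<in>space M. N t \<omega> - N s \<omega> = k}"
      by (subst emeasure_distr) (auto intro!: arg_cong[where f="emeasure M"])
    then show "emeasure (distr M (count_space UNIV) (\<lambda>\<omega>. N t \<omega> - N s \<omega>)) {k}
       = emeasure (density (count_space UNIV) (\<lambda>k. ennreal (exp (- ?m) * ?m ^ k / fact k))) {k}"
      by (simp add: emeasure_eq_measure N_increment_poisson[OF st] emeasure_density)
  qed auto
  also have "(\<integral>\<^sup>+k. ennreal (c ^ k) \<partial>density (count_space UNIV) (\<lambda>k. ennreal (exp (- ?m) * ?m ^ k / fact k)))
      = (\<Sum>k. ennreal (exp (- ?m) * ((c * ?m) ^ k / fact k)))"
    using m c by (subst nn_integral_density)
       (auto simp: nn_integral_count_space_nat ennreal_mult[symmetric] power_mult_distrib mult_ac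
         intro!: suminf_cong arg_cong[where f=ennreal])
  also have "\<dots> = ennreal (exp (- ?m) * exp (c * ?m))"
  proof (rule suminf_ennreal_eq)
    have "(\<lambda>k. (c * ?m) ^ k / fact k) sums exp (c * ?m)"
      using exp_converges[of "c * ?m"] by (simp add: divide_inverse mult.commute)
    then show "(\<lambda>k. exp (- ?m) * ((c * ?m) ^ k / fact k)) sums (exp (- ?m) * exp (c * ?m))"
      by (rule sums_mult)
    show "0 \<le> exp (- ?m) * ((c * ?m) ^ k / fact k)" for k using m c by simp
  qed
  also have "exp (- ?m) * exp (c * ?m) = exp (-((1 - c) * ?m))"
    by (simp add: exp_add[symmetric] algebra_simps)
  finally have "(\<integral>\<^sup>+\<omega>. ennreal (c ^ (N t \<omega> - N s \<omega>)) \<partial>M) = ennreal (exp (-((1 - c) * ?m)))" .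
  then show ?thesis using c by (subst integral_eq_nn_integral) auto
qed

text \<open>The generating functional identity on \<open>{0..t}\<close>, made a predicate so that it
  can be carried from one class of \<open>h\<close> to the next. The indicator stays attached to
  \<open>lam\<close>, since the product is what is known to be integrable.\<close>

definition has_pgfl :: "real \<Rightarrow> (real \<Rightarrow> real) \<Rightarrow> bool" where
  "has_pgfl t h \<longleftrightarrow> (\<integral>\<omega>. (\<Prod>i\<in>{1..N t \<omega>}. h (point N i \<omega>)) \<partial>M)
     = exp (- (\<integral>w. (1 - h w) * (indicator {0..t} w * lam w) \<partial>lborel))"

lemma lam_indicator_integrable: "0 \<le> t \<Longrightarrow> integrable lborel (\<lambda>w. indicator {0..t} w * lam w)"
  using lam_integrable[of t] by (simp add: set_integrable_def)

lemma lam_indicator_measurable: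
  "0 \<le> t \<Longrightarrow> (\<lambda>w. indicator {0..t} w * lam w) \<in> borel_measurable borel"
  using borel_measurable_integrable[OF lam_indicator_integrable[of t]] by simp

text \<open>A function constant on the cells of the grid turns the product into a product of powers of
  independent Poisson increments.\<close>

lemma has_pgfl_grid:
  assumes t: "0 < t" and n: "0 < n" and h: "\<And>x. 0 \<le> h x" "\<And>x. h x \<le> 1"
  shows "has_pgfl t (\<lambda>x. h (grid_ceiling t n x))"
proof -
  define ts where "ts k = t * real k / real n" for k
  define g where "g x = h (grid_ceiling t n x)" for x
  define f where "f w = (1 - g w) * lam w" for w
  have ts0: "ts 0 = 0" and tsn: "ts n = t" using n unfolding ts_def by auto
  have ts_nonneg: "0 \<le> ts k" for k using t unfolding ts_def by simp
  have ts_less: "ts k < ts (Suc k)" for k using t n unfolding ts_def by (simp add: field_simps)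
  have g_eq: "g x = h (ts (Suc k))" if "ts k < x" "x \<le> ts (Suc k)" for k x
    using grid_ceiling_eq[OF t n, of k x] that unfolding g_def ts_def by simp
  \<comment> \<open>Induction over the cells: the indices added between
    \<open>N (ts m) \<omega>\<close> and \<open>N (ts (Suc m)) \<omega>\<close> belong to points of
    the cell \<open>{ts m<..ts (Suc m)}\<close>, where \<open>g\<close> has the single value
    \<open>h (ts (Suc m))\<close>.\<close>
  have path: "(\<Prod>i\<in>{1..N (ts m) \<omega>}. g (point N i \<omega>))
      = (\<Prod>k<m. h (ts (Suc k)) ^ (N (ts (Suc k)) \<omega> - N (ts k) \<omega>))" if \<omega>: "\<omega> \<in> space M" for m \<omega>
  proof (induction m)
    case 0
    then show ?case using N_0[OF \<omega>] ts0 by simp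
  next
    case (Suc m)
    let ?a = "N (ts m) \<omega>" and ?b = "N (ts (Suc m)) \<omega>"
    have ab: "?a \<le> ?b" using N_mono[OF \<omega> ts_nonneg less_imp_le[OF ts_less]] .
    have "{1..?b} = {1..?a} \<union> {Suc ?a..?b}" using ab by auto
    then have "(\<Prod>i\<in>{1..?b}. g (point N i \<omega>))
        = (\<Prod>i\<in>{1..?a}. g (point N i \<omega>)) * (\<Prod>i\<in>{Suc ?a..?b}. g (point N i \<omega>))"
      by (simp add: prod.union_disjoint)
    also have "(\<Prod>i\<in>{Suc ?a..?b}. g (point N i \<omega>)) = (\<Prod>i\<in>{Suc ?a..?b}. h (ts (Suc m)))"
    proof (rule prod.cong[OF refl])
      fix i assume "i \<in> {Suc ?a..?b}"
      then have i: "?a < i" "i \<le> ?b" by auto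
      have "\<not> point N i \<omega> \<le> ts m" "point N i \<omega> \<le> ts (Suc m)"
        using point_le_iff[OF \<omega> ts_nonneg ts_nonneg i(2), of m] point_le[OF \<omega> ts_nonneg i(2)] i by auto
      then show "g (point N i \<omega>) = h (ts (Suc m))" by (intro g_eq) auto
    qed
    also have "\<dots> = h (ts (Suc m)) ^ (?b - ?a)" by simp
    finally show ?case using Suc by simp
  qed
  \<comment> \<open>The same cell-by-cell induction on the intensity side, so that the exponents of
    the increments add up to one integral.\<close>
  have integral: "set_integrable lborel {0..ts m} f \<and>
      (LINT w:{0..ts m}|lborel. f w) = (\<Sum>k<m. (1 - h (ts (Suc k))) * (cum_int lam (ts (Suc k)) - cum_int lam (ts k)))" for m
  proof (induction m)
    case 0
    have *: "(\<lambda>x. indicator {0..0} x *\<^sub>R f x) = (\<lambda>x::real. indicator {0} x *\<^sub>R f 0)"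
      by (auto simp: indicator_def)
    show ?case unfolding set_integrable_def set_lebesgue_integral_def ts0 * by simp
  next
    case (Suc m)
    let ?I = "{ts m<..ts (Suc m)}"
    have le: "ts m \<le> ts (Suc m)" using ts_less less_imp_le by blast
    have un: "{0..ts (Suc m)} = {0..ts m} \<union> ?I" using le ts_nonneg[of m] by auto
    have lamI: "set_integrable lborel ?I lam"
      using ts_nonneg by (intro set_integrable_subset[OF lam_integrable[of "ts (Suc m)"]]) (auto intro: order_trans[OF ts_nonneg less_imp_le])
    have eq: "(\<lambda>x. indicator ?I x *\<^sub>R f x) = (\<lambda>x. indicator ?I x *\<^sub>R ((1 - h (ts (Suc m))) * lam x))"
      using g_eq[of m] by (auto simp: f_def indicator_def fun_eq_iff)
    have i1: "set_integrable lborel ?I f"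
      using set_integrable_mult_right[of "1 - h (ts (Suc m))", OF lamI]
      unfolding set_integrable_def eq by simp
    have i2: "(LINT w:?I|lborel. f w) = (1 - h (ts (Suc m))) * (cum_int lam (ts (Suc m)) - cum_int lam (ts m))"
      unfolding cum_int_diff[OF ts_nonneg le] set_lebesgue_integral_def[of _ _ f] eq
      by (simp only: set_lebesgue_integral_def[symmetric] set_integral_mult_right)
    have "{0..ts m} \<inter> ?I = {}" by auto
    then show ?case unfolding un
      using set_integral_Un[of "{0..ts m}" ?I lborel f] set_integrable_Un[of lborel "{0..ts m}" f ?I] Suc i1 i2
      by auto
  qed
  have "(\<integral>\<omega>. (\<Prod>i\<in>{1..N t \<omega>}. g (point N i \<omega>)) \<partial>M)
      = (\<integral>\<omega>. (\<Prod>k<n. h (ts (Suc k)) ^ (N (ts (Suc k)) \<omega> - N (ts k) \<omega>)) \<partial>M)"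
    using path[of _ n] unfolding tsn by (intro Bochner_Integration.integral_cong) auto
  also have "\<dots> = (\<Prod>k<n. \<integral>\<omega>. h (ts (Suc k)) ^ (N (ts (Suc k)) \<omega> - N (ts k) \<omega>) \<partial>M)"
  proof (rule indep_vars_lebesgue_integral)
    show "indep_vars (\<lambda>_. borel) (\<lambda>k \<omega>. h (ts (Suc k)) ^ (N (ts (Suc k)) \<omega> - N (ts k) \<omega>)) {..<n}"
      by (rule indep_vars_compose2[OF N_indep_increments[of ts n], where Y="\<lambda>k j. h (ts (Suc k)) ^ j"])
        (use ts_nonneg ts_less in auto)
    fix k
    note [measurable] = N_measurable[OF ts_nonneg]
    show "integrable M (\<lambda>\<omega>. h (ts (Suc k)) ^ (N (ts (Suc k)) \<omega> - N (ts k) \<omega>))"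
      using h by (intro integrable_const_bound[where B=1]) (auto simp: power_le_one)
  qed simp
  also have "\<dots> = (\<Prod>k<n. exp (-((1 - h (ts (Suc k))) * (cum_int lam (ts (Suc k)) - cum_int lam (ts k)))))"
    by (intro prod.cong refl increment_pgf ts_nonneg less_imp_le[OF ts_less] h)
  also have "\<dots> = exp (- (LINT w:{0..ts n}|lborel. f w))"
    using integral[of n] by (simp add: exp_sum[symmetric] sum_negf)
  finally show ?thesis
    unfolding has_pgfl_def g_def[symmetric] tsn f_def set_lebesgue_integral_def
    by (simp add: mult_ac)
qed

text \<open>Dominated convergence on both sides: products of numbers in [0,1] are bounded by 1, and
  the integrand by \<open>lam\<close> on \<open>{0..t}\<close>. Convergence may fail on
  \<open>Z\<close>, which Lebesgue measure ignores; for the random points this must be supplied as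
  \<open>avoid\<close>.\<close>

lemma has_pgfl_limit:
  assumes t: "0 \<le> t" and Z: "Z \<in> null_sets lborel"
    and avoid: "AE \<omega> in M. \<forall>i\<in>{1..N t \<omega>}. point N i \<omega> \<notin> Z"
    and hn: "\<And>n. hn n \<in> borel_measurable borel" "\<And>n x. 0 \<le> hn n x" "\<And>n x. hn n x \<le> 1" "\<And>n. has_pgfl t (hn n)"
    and h: "h \<in> borel_measurable borel"
    and lim: "\<And>x. x \<notin> Z \<Longrightarrow> (\<lambda>n. hn n x) \<longlonglongrightarrow> h x"
  shows "has_pgfl t h"
proof -
  note [measurable] = hn(1) h lam_indicator_measurable[OF t]
  have "(\<lambda>n. \<integral>\<omega>. (\<Prod>i\<in>{1..N t \<omega>}. hn n (point N i \<omega>)) \<partial>M) \<longlonglongrightarrow> (\<integral>\<omega>. (\<Prod>i\<in>{1..N t \<omega>}. h (point N i \<omega>)) \<partial>M)"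
  proof (rule integral_dominated_convergence[where w="\<lambda>_. 1"])
    show "AE \<omega> in M. (\<lambda>n. \<Prod>i\<in>{1..N t \<omega>}. hn n (point N i \<omega>)) \<longlonglongrightarrow> (\<Prod>i\<in>{1..N t \<omega>}. h (point N i \<omega>))"
      using avoid by eventually_elim (auto intro!: tendsto_prod lim)
    show "AE \<omega> in M. norm (\<Prod>i\<in>{1..N t \<omega>}. hn n (point N i \<omega>)) \<le> 1" for n
      using hn(2,3) by (auto simp: prod_nonneg intro!: prod_le_1)
  qed (use prod_points_measurable[OF t] hn(1) h in simp_all)
  moreover have "(\<lambda>n. exp (- (\<integral>w. (1 - hn n w) * (indicator {0..t} w * lam w) \<partial>lborel)))
      \<longlonglongrightarrow> exp (- (\<integral>w. (1 - h w) * (indicator {0..t} w * lam w) \<partial>lborel))"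
  proof (intro tendsto_exp tendsto_minus integral_dominated_convergence[where w="\<lambda>w. indicator {0..t} w * lam w"])
    show "AE w in lborel. (\<lambda>n. (1 - hn n w) * (indicator {0..t} w * lam w)) \<longlonglongrightarrow> (1 - h w) * (indicator {0..t} w * lam w)"
      using AE_not_in[OF Z] by eventually_elim (intro tendsto_intros lim)
    show "AE w in lborel. norm ((1 - hn n w) * (indicator {0..t} w * lam w)) \<le> indicator {0..t} w * lam w" for n
      using hn(2,3) lam_nonneg by (auto simp: abs_mult intro!: mult_left_le_one_le)
  qed (auto simp: lam_indicator_integrable t)
  ultimately show ?thesis
    using hn(4) LIMSEQ_unique unfolding has_pgfl_def by auto
qed

text \<open>Treated apart because the grid has mesh t/n and its definition divides by
  \<open>t\<close>.\<close>

lemma has_pgfl_0: "has_pgfl 0 h"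
proof -
  have "AE w in lborel. (1 - h w) * (indicator {0..0} w * lam w) = (0::real)"
    using AE_lborel_singleton[of 0] by eventually_elim auto
  then have "(\<integral>w. (1 - h w) * (indicator {0..0} w * lam w) \<partial>lborel) = 0"
    by (rule integral_eq_zero_AE)
  moreover have "(\<integral>\<omega>. (\<Prod>i\<in>{1..N 0 \<omega>}. h (point N i \<omega>)) \<partial>M) = (\<integral>\<omega>. 1 \<partial>M)"
    using N_0 by (intro Bochner_Integration.integral_cong) auto
  ultimately show ?thesis unfolding has_pgfl_def by (simp add: prob_space)
qed

lemma has_pgfl_continuous:
  assumes t: "0 \<le> t" and cont: "continuous_on UNIV h" and h: "\<And>x. 0 \<le> h x" "\<And>x. h x \<le> 1"
  shows "has_pgfl t h"
proof (cases "t = 0")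
  case True
  then show ?thesis using has_pgfl_0 by simp
next
  case False
  then have t': "0 < t" using t by simp
  have [measurable]: "h \<in> borel_measurable borel" using cont by (rule borel_measurable_continuous_onI)
  show ?thesis
  proof (rule has_pgfl_limit[OF t, where Z="{}" and hn="\<lambda>n x. h (grid_ceiling t (Suc n) x)"])
    show "has_pgfl t (\<lambda>x. h (grid_ceiling t (Suc n) x))" for n by (rule has_pgfl_grid[OF t' _ h]) simp
    show "(\<lambda>n. h (grid_ceiling t (Suc n) x)) \<longlonglongrightarrow> h x" for x
      using cont grid_ceiling_tendsto[OF t'] by (intro isCont_tendsto_compose[of x h]) (auto simp: continuous_on_eq_continuous_at)
    show "(\<lambda>x. h (grid_ceiling t (Suc n) x)) \<in> borel_measurable borel" for n
      unfolding grid_ceiling_def by measurable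
  qed (use h in auto)
qed

text \<open>For this indicator the left side of the identity is the probability that no point falls
  in \<open>U\<close>. The approximations by distance to the complement converge everywhere, so the
  exceptional set is empty. The complement must be nonempty because \<open>infdist\<close> to the
  empty set is 0 by convention.\<close>

lemma has_pgfl_avoid_open:
  assumes t: "0 \<le> t" and U: "open U" "U \<noteq> UNIV"
  shows "has_pgfl t (indicator (- U))"
proof (rule has_pgfl_limit[OF t, where Z="{}" and hn="\<lambda>n x. 1 - min 1 (real n * infdist x (- U))"])
  have cl: "closed (- U)" "- U \<noteq> {}" using U by auto
  show "(\<lambda>n. 1 - min 1 (real n * infdist x (- U))) \<longlonglongrightarrow> indicator (- U) x" for x
  proof (cases "x \<in> U")
    case True
    then have p: "0 < infdist x (- U)"
      using in_closed_iff_infdist_zero[OF cl, of x] infdist_nonneg[of x "- U"] by (auto simp: less_le)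
    obtain n0 :: nat where n0: "1 / infdist x (- U) < n0" using reals_Archimedean2 by blast
    have "\<forall>\<^sub>F n in sequentially. 1 - min 1 (real n * infdist x (- U)) = 0"
      using eventually_ge_at_top[of n0]
    proof eventually_elim
      case (elim n)
      then have "1 / infdist x (- U) < n" using n0 by linarith
      then show ?case using p by (simp add: field_simps)
    qed
    then show ?thesis using True by (simp add: tendsto_eventually)
  next
    case False
    then have "infdist x (- U) = 0" using in_closed_iff_infdist_zero[OF cl, of x] by simp
    then show ?thesis using False by simp
  qed
  show "has_pgfl t (\<lambda>x. 1 - min 1 (real n * infdist x (- U)))" for n
    by (intro has_pgfl_continuous[OF t]) (auto intro!: continuous_intros mult_nonneg_nonneg infdist_nonneg)
  show "(indicator (- U) :: real \<Rightarrow> real) \<in> borel_measurable borel"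
    using cl by (intro borel_measurable_indicator) auto
  show "(\<lambda>x. 1 - min 1 (real n * infdist x (- U))) \<in> borel_measurable borel" for n
    by (intro borel_measurable_continuous_onI) (auto intro!: continuous_intros)
qed (auto simp: infdist_nonneg intro!: mult_nonneg_nonneg)

text \<open>Enclosing the null set in open sets of small intensity and letting \<open>h\<close> be the indicator of the
  complement bounds the probability of hitting it.\<close>

lemma points_avoid_null_set:
  assumes t: "0 \<le> t" and A: "A \<in> null_sets lborel"
  shows "AE \<omega> in M. \<forall>i\<in>{1..N t \<omega>}. point N i \<omega> \<notin> A"
proof -
  let ?L = "\<lambda>w. indicator {0..t} w * lam w"
  \<comment> \<open>The intensity measure on \<open>{0..t}\<close>: absolutely continuous, hence
    zero on \<open>A\<close>, and finite, hence outer regular.\<close>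
  let ?R = "density lborel (\<lambda>w. ennreal (?L w))"
  note [measurable] = lam_indicator_measurable[OF t]
  have L0: "0 \<le> ?L w" for w using lam_nonneg by simp
  have [measurable]: "A \<in> sets borel" using A by auto
  let ?E = "\<lambda>\<omega>. \<Prod>i\<in>{1..N t \<omega>}. indicator (- A) (point N i \<omega>) :: real"
  have E[measurable]: "?E \<in> borel_measurable M" by (rule prod_points_measurable[OF t]) measurable
  have E01: "0 \<le> ?E \<omega>" "?E \<omega> \<le> 1" for \<omega> by (auto intro!: prod_nonneg prod_le_1)
  \<comment> \<open>The left side is the probability of hitting \<open>A\<close>. It is at most that
    of hitting an open \<open>W\<close> of intensity below \<open>e\<close>, which is 1 - exp(-x) <=
    x, with x the intensity of \<open>W\<close>.\<close>
  have "1 - (\<integral>\<omega>. ?E \<omega> \<partial>M) \<le> 0 + e" if e: "0 < e" for e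
  proof -
    have "emeasure ?R UNIV = (\<integral>\<^sup>+w. ennreal (?L w) \<partial>lborel)" by (simp add: emeasure_density)
    also have "\<dots> = ennreal (\<integral>w. ?L w \<partial>lborel)"
      using lam_indicator_integrable[OF t] L0 by (intro nn_integral_eq_integral) auto
    finally have fin: "emeasure ?R (space ?R) \<noteq> \<infinity>" by simp
    have "AE w in lborel. ennreal (?L w) * indicator A w = 0"
      using AE_not_in[OF A] by eventually_elim simp
    then have "emeasure ?R A = 0" by (simp add: emeasure_density nn_integral_0_iff_AE)
    moreover have "emeasure ?R A = (INF U \<in> {U. A \<subseteq> U \<and> open U}. emeasure ?R U)"
      using fin by (intro outer_regular) auto
    ultimately have "(INF U \<in> {U. A \<subseteq> U \<and> open U}. emeasure ?R U) < ennreal e"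
      using e by simp
    then obtain U where U: "A \<subseteq> U" "open U" "emeasure ?R U < ennreal e"
      unfolding INF_less_iff by auto
    \<comment> \<open>Points are strictly positive, so no hit of \<open>A\<close> is lost, and the
      intersection is certainly not \<open>UNIV\<close>.\<close>
    define W where "W = U \<inter> {0<..}"
    have W: "open W" "W \<noteq> UNIV" "W \<subseteq> U" using U(2) unfolding W_def by auto
    have [measurable]: "W \<in> sets borel" using W(1) by measurable
    let ?F = "\<lambda>\<omega>. \<Prod>i\<in>{1..N t \<omega>}. indicator (- W) (point N i \<omega>) :: real"
    have F[measurable]: "?F \<in> borel_measurable M" by (rule prod_points_measurable[OF t]) measurable
    have F01: "0 \<le> ?F \<omega>" "?F \<omega> \<le> 1" for \<omega> by (auto intro!: prod_nonneg prod_le_1)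
    have "?F \<omega> \<le> ?E \<omega>" if "\<omega> \<in> space M" for \<omega>
    proof (rule prod_mono)
      fix i assume "i \<in> {1..N t \<omega>}"
      then show "0 \<le> (indicator (- W) (point N i \<omega>) :: real) \<and> (indicator (- W) (point N i \<omega>) :: real) \<le> indicator (- A) (point N i \<omega>)"
        using point_pos[OF that t, of i] U(1) unfolding W_def by (auto simp: indicator_def)
    qed
    then have "(\<integral>\<omega>. ?F \<omega> \<partial>M) \<le> (\<integral>\<omega>. ?E \<omega> \<partial>M)"
    proof (intro integral_mono integrable_const_bound[where B=1])
      show "AE \<omega> in M. norm (?F \<omega>) \<le> 1" "AE \<omega> in M. norm (?E \<omega>) \<le> 1" using E01 F01 by simp_all
    qed (rule E F | assumption)+
    moreover have "(\<integral>\<omega>. ?F \<omega> \<partial>M) = exp (- (\<integral>w. (1 - indicator (- W) w) * ?L w \<partial>lborel))"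
      using has_pgfl_avoid_open[OF t W(1,2)] unfolding has_pgfl_def .
    moreover have "(\<integral>w. (1 - indicator (- W) w) * ?L w \<partial>lborel) \<le> e"
    proof -
      have "ennreal (\<integral>w. (1 - indicator (- W) w) * ?L w \<partial>lborel) = (\<integral>\<^sup>+w. ennreal ((1 - indicator (- W) w) * ?L w) \<partial>lborel)"
        by (intro nn_integral_eq_integral[symmetric] Bochner_Integration.integrable_bound[OF lam_indicator_integrable[OF t]])
          (auto simp: L0 lam_nonneg split: split_indicator)
      also have "\<dots> = emeasure ?R W"
        by (subst emeasure_density) (auto intro!: nn_integral_cong split: split_indicator)
      also have "\<dots> \<le> emeasure ?R U" by (rule emeasure_mono[OF W(3)]) (use U(2) in simp)
      also have "\<dots> < ennreal e" by fact
      finally have "ennreal (\<integral>w. (1 - indicator (- W) w) * ?L w \<partial>lborel) \<le> ennreal e"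
        by (rule less_imp_le)
      then show ?thesis using e by (simp only: ennreal_le_iff less_imp_le)
    qed
    ultimately show ?thesis
      using exp_ge_add_one_self[of "- (\<integral>w. (1 - indicator (- W) w) * ?L w \<partial>lborel)"] by linarith
  qed
  then have "1 - (\<integral>\<omega>. ?E \<omega> \<partial>M) \<le> 0" by (rule field_le_epsilon)
  moreover have int: "integrable M ?E"
    by (rule integrable_const_bound[where B=1, OF _ E]) (use E01 in simp)
  moreover have "(\<integral>\<omega>. 1 - ?E \<omega> \<partial>M) = 1 - (\<integral>\<omega>. ?E \<omega> \<partial>M)" using int by (simp add: prob_space)
  moreover have "0 \<le> (\<integral>\<omega>. 1 - ?E \<omega> \<partial>M)"
    by (rule Bochner_Integration.integral_nonneg) (use E01 in simp)
  ultimately have "(\<integral>\<omega>. 1 - ?E \<omega> \<partial>M) = 0" by linarith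
  moreover have "integrable M (\<lambda>\<omega>. 1 - ?E \<omega>)" by (rule Bochner_Integration.integrable_diff[OF integrable_const int])
  moreover have "AE \<omega> in M. 0 \<le> 1 - ?E \<omega>" using E01(2) by (intro AE_I2) (simp only: le_diff_eq add_0)
  ultimately have "AE \<omega> in M. 1 - ?E \<omega> = 0"
    using integral_nonneg_eq_0_iff_AE by blast
  then show ?thesis
  proof eventually_elim
    case (elim \<omega>)
    show ?case
    proof
      fix i assume i: "i \<in> {1..N t \<omega>}"
      show "point N i \<omega> \<notin> A"
      proof
        assume "point N i \<omega> \<in> A"
        then have "\<exists>j\<in>{1..N t \<omega>}. indicator (- A) (point N j \<omega>) = (0::real)"
          using i by (intro bexI[of _ i]) simp_all
        then have "?E \<omega> = 0" by (intro prod_zero) simp_all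
        then have "1 - ?E \<omega> = 1" by (simp only: diff_zero)
        then show False unfolding elim by (rule zero_neq_one[THEN notE])
      qed
    qed
  qed
qed

text \<open>A measurable function is an a.e. limit of continuous ones, and the points almost surely avoid
  the exceptional null set.\<close>

lemma probability_generating_functional:
  assumes t: "0 \<le> t" and h[measurable]: "h \<in> borel_measurable borel"
    and h01: "\<And>x. 0 \<le> h x" "\<And>x. h x \<le> 1"
  shows "(\<integral>\<omega>. (\<Prod>i\<in>{1..N t \<omega>}. h (point N i \<omega>)) \<partial>M)
     = exp (- (\<integral>w. (1 - h w) * (indicator {0..t} w * lam w) \<partial>lborel))"
proof -
  have "h measurable_on UNIV"
    using h by (intro lebesgue_measurable_imp_measurable_on_real) (auto intro: measurable_completion)
  then obtain Z g where Z: "negligible Z" and g: "\<And>n. continuous_on UNIV (g n)"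
      "\<And>x. x \<notin> Z \<Longrightarrow> (\<lambda>n. g n x) \<longlonglongrightarrow> h x"
    unfolding measurable_on_def by auto
  \<comment> \<open>A negligible set is null only for the completion; it is enlarged to a Borel null
    set, as the avoidance lemma requires.\<close>
  have "Z \<in> null_sets lebesgue" using Z negligible_iff_null_sets by blast
  then obtain Z' where Z': "Z' \<in> null_sets lborel" "Z \<subseteq> Z'"
    unfolding null_sets_completion_iff2 by blast
  \<comment> \<open>Truncation to [0,1] keeps continuity and, as \<open>h\<close> takes values in
    [0,1], also the limit.\<close>
  let ?h = "\<lambda>n x. min 1 (max 0 (g n x))"
  have c: "continuous_on UNIV (?h n)" for n by (intro continuous_intros g)
  have "has_pgfl t h"
  proof (rule has_pgfl_limit[OF t Z'(1) points_avoid_null_set[OF t Z'(1)], where hn="?h"])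
    show "has_pgfl t (?h n)" for n by (rule has_pgfl_continuous[OF t c]) auto
    show "?h n \<in> borel_measurable borel" for n by (rule borel_measurable_continuous_onI[OF c])
    fix x assume "x \<notin> Z'"
    then have "(\<lambda>n. ?h n x) \<longlonglongrightarrow> min 1 (max 0 (h x))"
      using Z' by (intro tendsto_intros g(2)) auto
    then show "(\<lambda>n. ?h n x) \<longlonglongrightarrow> h x" using h01[of x] by simp
  qed (use h in auto)
  then show ?thesis unfolding has_pgfl_def .
qed

end

section \<open>Averaging over the marks\<close>

lemma sets_vimage_algebra_gen_events:
  "X \<in> measurable M M' \<Longrightarrow> sets (vimage_algebra (space M) X M') = gen_events M X M'"
  unfolding gen_events_def by (rule sets_vimage_algebra2) (auto dest: measurable_space)

text \<open>Independence is assumed for the events generated by whole paths, whereas the variables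
  at hand are functionals of these paths. Measurability with respect to the two sub-sigma-algebras
  transfers the product rule to them.\<close>

lemma (in prob_space) distr_pair_subalgebra:
  assumes sp: "space A = space M" "space B = space M"
    and sub: "sets A \<subseteq> events" "sets B \<subseteq> events"
    and indep: "\<And>a b. a \<in> sets A \<Longrightarrow> b \<in> sets B \<Longrightarrow> prob (a \<inter> b) = prob a * prob b"
    and X: "X \<in> measurable A S" and Y: "Y \<in> measurable B T"
  shows "distr M S X \<Otimes>\<^sub>M distr M T Y = distr M (S \<Otimes>\<^sub>M T) (\<lambda>\<omega>. (X \<omega>, Y \<omega>))"
proof (rule pair_measure_eqI)
  have X': "X \<in> measurable M S" and Y': "Y \<in> measurable M T"
    using X Y sub sp unfolding measurable_def by auto
  interpret X: prob_space "distr M S X" using X' by (rule prob_space_distr)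
  interpret Y: prob_space "distr M T Y" using Y' by (rule prob_space_distr)
  show "sigma_finite_measure (distr M S X)" "sigma_finite_measure (distr M T Y)" by unfold_locales
  show "sets (distr M S X \<Otimes>\<^sub>M distr M T Y) = sets (distr M (S \<Otimes>\<^sub>M T) (\<lambda>\<omega>. (X \<omega>, Y \<omega>)))" by simp
  fix C D assume "C \<in> sets (distr M S X)" "D \<in> sets (distr M T Y)"
  then have CD: "C \<in> sets S" "D \<in> sets T" by simp_all
  have "(\<lambda>\<omega>. (X \<omega>, Y \<omega>)) -` (C \<times> D) \<inter> space M = (X -` C \<inter> space M) \<inter> (Y -` D \<inter> space M)" by auto
  moreover have "prob ((X -` C \<inter> space M) \<inter> (Y -` D \<inter> space M)) = prob (X -` C \<inter> space M) * prob (Y -` D \<inter> space M)"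
    using measurable_sets[OF X CD(1)] measurable_sets[OF Y CD(2)] sp by (intro indep) auto
  ultimately show "emeasure (distr M S X) C * emeasure (distr M T Y) D
      = emeasure (distr M (S \<Otimes>\<^sub>M T) (\<lambda>\<omega>. (X \<omega>, Y \<omega>))) (C \<times> D)"
    using X' Y' CD by (simp add: emeasure_distr measurable_Pair emeasure_eq_measure ennreal_mult)
qed

lemma nn_integral_distr_borel:
  "T \<in> measurable M M' \<Longrightarrow> f \<in> borel_measurable M' \<Longrightarrow>
    (\<integral>\<^sup>+x. f x \<partial>distr M M' T) = (\<integral>\<^sup>+x. f (T x) \<partial>M)"
  by (rule nn_integral_distr) simp_all

section \<open>The shock model: points, marks and their independence\<close>

locale shocks =
  fixes M :: "'a measure" and lam q :: "real \<Rightarrow> real" and N :: "real \<Rightarrow> 'a \<Rightarrow> nat"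
    and V :: "nat \<Rightarrow> 'a \<Rightarrow> real \<times> real" and \<mu> :: "(real \<times> real) measure"
    and G :: "real \<Rightarrow> 'a \<Rightarrow> real"
  assumes model: "shock_model M lam q N V \<mu> G"

sublocale shocks \<subseteq> nhpp M lam N
  using model unfolding shock_model_def nhpp_def nhpp_axioms_def by blast

context shocks begin

lemma V_measurable: "1 \<le> i \<Longrightarrow> V i \<in> borel_measurable M"
  and distr_V: "1 \<le> i \<Longrightarrow> distr M borel (V i) = \<mu>"
  and AE_V_nonneg: "1 \<le> i \<Longrightarrow> AE \<omega> in M. 0 \<le> fst (V i \<omega>) \<and> 0 \<le> snd (V i \<omega>)"
  and indep_V: "indep_vars (\<lambda>_. borel) V {1..}"
  and q_bounds: "0 \<le> x \<Longrightarrow> 0 \<le> q x" "0 \<le> x \<Longrightarrow> q x \<le> 1"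
  and q_measurable: "(\<lambda>x. indicator {0..} x * q x) \<in> borel_measurable borel"
  and G_measurable: "0 \<le> t \<Longrightarrow> G t \<in> borel_measurable M"
  and G_nonneg: "0 \<le> t \<Longrightarrow> \<omega> \<in> space M \<Longrightarrow> 0 \<le> G t \<omega>"
  using model unfolding shock_model_def set_borel_measurable_def by (simp_all only: real_scaleR_def)

lemma prob_space_mu: "prob_space \<mu>"
  using prob_space_distr[OF V_measurable[of 1]] distr_V[of 1] by simp

lemma sets_mu: "sets \<mu> = sets borel"
  using distr_V[of 1] by (metis sets_distr order_refl)

lemma AE_mu_nonneg: "AE v in \<mu>. 0 \<le> fst v \<and> 0 \<le> snd v"
proof -
  have "AE v in distr M borel (V 1). 0 \<le> fst v \<and> 0 \<le> snd v"
  proof (subst AE_distr_iff)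
    show "V 1 \<in> borel_measurable M" using V_measurable by simp
    have "{x :: real \<times> real. 0 \<le> fst x \<and> 0 \<le> snd x} \<in> sets borel"
      by (intro borel_closed closed_Collect_conj closed_Collect_le continuous_intros)
    then show "{x \<in> space borel. 0 \<le> fst x \<and> 0 \<le> snd x} \<in> sets (borel :: (real \<times> real) measure)" by simp
    show "AE x in M. 0 \<le> fst (V 1 x) \<and> 0 \<le> snd (V 1 x)" using AE_V_nonneg by simp
  qed
  then show ?thesis unfolding distr_V[OF order_refl] .
qed

lemma point_clip_measurable:
  "0 \<le> t \<Longrightarrow> (\<lambda>\<omega>. if i \<in> {1..N t \<omega>} then point N i \<omega> else 0) \<in> borel_measurable M"
  by (rule point_measurable[OF refl N_measurable])

text \<open>Points after time \<open>t\<close> are replaced by \<open>0\<close>: if fewer than \<open>i\<close> shocks ever occur, \<^term>\<open>point N i \<omega>\<close> is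
  the infimum of the empty set.\<close>

lemma distr_points_shocks:
  assumes t: "0 \<le> t"
  defines "S \<equiv> count_space UNIV \<Otimes>\<^sub>M (\<Pi>\<^sub>M i\<in>UNIV. borel)" and "T \<equiv> \<Pi>\<^sub>M i\<in>{1..}. borel"
    and "X \<equiv> \<lambda>\<omega>. (N t \<omega>, \<lambda>i. if i \<in> {1..N t \<omega>} then point N i \<omega> else 0)"
    and "Y \<equiv> \<lambda>\<omega>. restrict (\<lambda>i. V i \<omega>) {1..}"
  shows "distr M S X \<Otimes>\<^sub>M distr M T Y = distr M (S \<Otimes>\<^sub>M T) (\<lambda>\<omega>. (X \<omega>, Y \<omega>))"
  unfolding S_def T_def X_def Y_def
proof -
  let ?XN = "\<lambda>\<omega>. restrict (\<lambda>t. N t \<omega>) {0..}" and ?XV = "\<lambda>\<omega>. restrict (\<lambda>i. V i \<omega>) {1..}"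
  let ?X = "\<lambda>\<omega>. (N t \<omega>, \<lambda>i. if i \<in> {1..N t \<omega>} then point N i \<omega> else 0)"
  let ?S = "count_space UNIV \<Otimes>\<^sub>M (\<Pi>\<^sub>M i\<in>UNIV. borel) :: (nat \<times> (nat \<Rightarrow> real)) measure"
  let ?PN = "PiM {0..} (\<lambda>_. count_space UNIV) :: (real \<Rightarrow> nat) measure"
  let ?PV = "PiM {1..} (\<lambda>_. borel) :: (nat \<Rightarrow> real \<times> real) measure"
  have XN: "?XN \<in> measurable M ?PN" and XV: "?XV \<in> measurable M ?PV"
    using model unfolding shock_model_def by blast+
  \<comment> \<open>\<open>A\<close> and \<open>B\<close> are the sigma-algebras generated by the
    path of \<open>N\<close> and by the sequence of marks; their sets are exactly the
    \<open>gen_events\<close> whose independence the model states.\<close>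
  define A where "A = vimage_algebra (space M) ?XN ?PN"
  define B where "B = vimage_algebra (space M) ?XV ?PV"
  have sA: "sets A = gen_events M ?XN ?PN" unfolding A_def by (rule sets_vimage_algebra_gen_events[OF XN])
  have sB: "sets B = gen_events M ?XV ?PV" unfolding B_def by (rule sets_vimage_algebra_gen_events[OF XV])
  have XNA: "?XN \<in> measurable A ?PN" unfolding A_def
    using measurable_space[OF XN] by (intro measurable_vimage_algebra1) auto
  have XVB: "?XV \<in> measurable B ?PV" unfolding B_def
    using measurable_space[OF XV] by (intro measurable_vimage_algebra1) auto
  have spA: "space A = space M" and spB: "space B = space M" unfolding A_def B_def by simp_all
  have NA: "N s \<in> measurable A (count_space UNIV)" if "0 \<le> s" for s
    using measurable_compose[OF XNA measurable_component_singleton[of s]] that by simp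
  obtain F where F: "indep_sets F {0, 1, 2::nat}" "F 0 = sets A" "F 1 = sets B"
    using model unfolding shock_model_def sA sB by fastforce
  have "prob (a \<inter> b) = prob a * prob b" if "a \<in> sets A" "b \<in> sets B" for a b
    using indep_setsD[OF F(1), of "{0, 1}" "\<lambda>j. if j = 0 then a else b"] F that by (simp add: Int_commute)
  note prod_eq = this
  show "distr M ?S ?X \<Otimes>\<^sub>M distr M ?PV ?XV = distr M (?S \<Otimes>\<^sub>M ?PV) (\<lambda>\<omega>. (?X \<omega>, ?XV \<omega>))"
  proof (rule distr_pair_subalgebra[OF spA spB _ _ prod_eq])
    show "sets A \<subseteq> events" "sets B \<subseteq> events" using F unfolding indep_sets_def by auto
    show "?X \<in> measurable A ?S"
      by (intro measurable_Pair NA[OF t] measurable_PiM_single' point_measurable[OF spA NA t]) auto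
    show "?XV \<in> measurable B ?PV" by (rule XVB)
  qed
qed

text \<open>Conditioning on the points, written as Tonelli for the product law of points and marks.
  Nonnegative integrals avoid any integrability condition on \<open>f\<close>.\<close>

lemma nn_integral_mark_average:
  fixes f :: "real \<times> real \<times> real \<Rightarrow> ennreal"
  assumes t: "0 \<le> t" and f[measurable]: "f \<in> borel_measurable borel"
  shows "(\<integral>\<^sup>+\<omega>. (\<Prod>i\<in>{1..N t \<omega>}. f (point N i \<omega>, V i \<omega>)) \<partial>M)
    = (\<integral>\<^sup>+\<omega>. (\<Prod>i\<in>{1..N t \<omega>}. \<integral>\<^sup>+v. f (point N i \<omega>, v) \<partial>\<mu>) \<partial>M)"
proof -
  let ?X = "\<lambda>\<omega>. (N t \<omega>, \<lambda>i. if i \<in> {1..N t \<omega>} then point N i \<omega> else 0)"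
  let ?Y = "\<lambda>\<omega>. restrict (\<lambda>i. V i \<omega>) {1..}"
  let ?S = "count_space UNIV \<Otimes>\<^sub>M (\<Pi>\<^sub>M i\<in>UNIV. borel) :: (nat \<times> (nat \<Rightarrow> real)) measure"
  let ?T = "PiM {1..} (\<lambda>_. borel) :: (nat \<Rightarrow> real \<times> real) measure"
  \<comment> \<open>The random product as a function of the pair whose joint law is a product: count
    and clipped points on one side, all marks on the other.\<close>
  define g where "g p = (\<Prod>i\<in>{1..fst (fst p)}. f (snd (fst p) i, snd p i))"
    for p :: "(nat \<times> (nat \<Rightarrow> real)) \<times> (nat \<Rightarrow> real \<times> real)"
  have f'[measurable]: "f \<in> borel_measurable (borel \<Otimes>\<^sub>M borel)" using f by (simp add: borel_prod)
  have g[measurable]: "g \<in> borel_measurable (?S \<Otimes>\<^sub>M ?T)"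
    unfolding g_def
  proof (rule measurable_compose_countable[where g="\<lambda>p. fst (fst p)"])
    fix n :: nat
    show "(\<lambda>p. \<Prod>i\<in>{1..n}. f (snd (fst p) i, snd p i)) \<in> borel_measurable (?S \<Otimes>\<^sub>M ?T)"
    proof (rule borel_measurable_prod_ennreal)
      fix i assume i: "i \<in> {1..n}"
      have "(\<lambda>p. snd (fst p) i) \<in> borel_measurable (?S \<Otimes>\<^sub>M ?T)"
        by (rule measurable_compose[OF measurable_compose[OF measurable_fst measurable_snd] measurable_component_singleton]) simp
      moreover have "(\<lambda>p. snd p i) \<in> borel_measurable (?S \<Otimes>\<^sub>M ?T)"
        by (rule measurable_compose[OF measurable_snd measurable_component_singleton]) (use i in simp)
      ultimately have "(\<lambda>p. (snd (fst p) i, snd p i)) \<in> measurable (?S \<Otimes>\<^sub>M ?T) (borel \<Otimes>\<^sub>M borel)"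
        by (rule measurable_Pair)
      then show "(\<lambda>p. f (snd (fst p) i, snd p i)) \<in> borel_measurable (?S \<Otimes>\<^sub>M ?T)"
        by (rule measurable_compose[OF _ f'])
    qed
  qed (rule measurable_compose[OF measurable_fst measurable_fst])
  have g_cong: "g \<in> borel_measurable (A \<Otimes>\<^sub>M B)" if "sets A = sets ?S" "sets B = sets ?T" for A B
    using g measurable_cong_sets[OF sets_pair_measure_cong[OF that] refl] by blast
  have eq: "distr M ?S ?X \<Otimes>\<^sub>M distr M ?T ?Y = distr M (?S \<Otimes>\<^sub>M ?T) (\<lambda>\<omega>. (?X \<omega>, ?Y \<omega>))"
    by (rule distr_points_shocks[OF t])
  have X: "?X \<in> measurable M ?S"
    by (intro measurable_Pair N_measurable[OF t] measurable_PiM_single' point_clip_measurable[OF t]) auto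
  have Y: "?Y \<in> measurable M ?T"
    by (intro measurable_restrict V_measurable) simp
  interpret Y: prob_space "distr M ?T ?Y" using Y by (rule prob_space_distr)
  have "(\<integral>\<^sup>+\<omega>. (\<Prod>i\<in>{1..N t \<omega>}. f (point N i \<omega>, V i \<omega>)) \<partial>M) = (\<integral>\<^sup>+\<omega>. g (?X \<omega>, ?Y \<omega>) \<partial>M)"
    unfolding g_def by (intro nn_integral_cong prod.cong) simp_all
  also have "\<dots> = (\<integral>\<^sup>+p. g p \<partial>distr M (?S \<Otimes>\<^sub>M ?T) (\<lambda>\<omega>. (?X \<omega>, ?Y \<omega>)))"
    by (rule nn_integral_distr_borel[symmetric, OF measurable_Pair[OF X Y] g])
  also have "\<dots> = (\<integral>\<^sup>+x. \<integral>\<^sup>+y. g (x, y) \<partial>distr M ?T ?Y \<partial>distr M ?S ?X)"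
    unfolding eq[symmetric] by (rule Y.nn_integral_fst[symmetric, OF g_cong[OF sets_distr sets_distr]])
  also have "\<dots> = (\<integral>\<^sup>+\<omega>. \<integral>\<^sup>+y. g (?X \<omega>, y) \<partial>distr M ?T ?Y \<partial>M)"
    by (rule nn_integral_distr_borel[OF X Y.borel_measurable_nn_integral_fst[OF g_cong[OF refl sets_distr]]])
  also have "\<dots> = (\<integral>\<^sup>+\<omega>. (\<Prod>i\<in>{1..N t \<omega>}. \<integral>\<^sup>+v. f (point N i \<omega>, v) \<partial>\<mu>) \<partial>M)"
  proof (rule nn_integral_cong)
    \<comment> \<open>With the points frozen at \<open>\<omega>\<close> the number of factors is
      fixed, and the marks come from a separate sample, so their independence splits the integral of
      the product.\<close>
    fix \<omega> assume \<omega>: "\<omega> \<in> space M"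
    have fV: "(\<lambda>v. f (w, v)) \<in> borel_measurable borel" for w by measurable
    have "(\<integral>\<^sup>+y. g (?X \<omega>, y) \<partial>distr M ?T ?Y) = (\<integral>\<^sup>+\<omega>'. g (?X \<omega>, ?Y \<omega>') \<partial>M)"
      using measurable_space[OF X \<omega>]
      by (intro nn_integral_distr_borel[OF Y] measurable_compose[OF measurable_Pair1' g])
    also have "\<dots> = (\<integral>\<^sup>+\<omega>'. (\<Prod>i\<in>{1..N t \<omega>}. f (point N i \<omega>, V i \<omega>')) \<partial>M)"
      unfolding g_def by (intro nn_integral_cong) (auto intro!: prod.cong)
    also have "\<dots> = (\<Prod>i\<in>{1..N t \<omega>}. \<integral>\<^sup>+\<omega>'. f (point N i \<omega>, V i \<omega>') \<partial>M)"
      by (intro indep_vars_nn_integral indep_vars_compose2[OF indep_vars_subset[OF indep_V], where Y="\<lambda>i v. f (point N i \<omega>, v)"])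
        (auto intro: fV)
    also have "\<dots> = (\<Prod>i\<in>{1..N t \<omega>}. \<integral>\<^sup>+v. f (point N i \<omega>, v) \<partial>\<mu>)"
    proof (rule prod.cong[OF refl])
      fix i assume "i \<in> {1..N t \<omega>}"
      then have i: "1 \<le> i" by simp
      show "(\<integral>\<^sup>+\<omega>'. f (point N i \<omega>, V i \<omega>') \<partial>M) = (\<integral>\<^sup>+v. f (point N i \<omega>, v) \<partial>\<mu>)"
        unfolding distr_V[OF i, symmetric] by (rule nn_integral_distr_borel[symmetric, OF V_measurable[OF i] fV])
    qed
    finally show "(\<integral>\<^sup>+y. g (?X \<omega>, y) \<partial>distr M ?T ?Y) = (\<Prod>i\<in>{1..N t \<omega>}. \<integral>\<^sup>+v. f (point N i \<omega>, v) \<partial>\<mu>)" .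
  qed
  finally show ?thesis .
qed

end

section \<open>The discounted law of the accumulated damage\<close>

lemma borel_measurable_fst: "fst \<in> borel_measurable (borel :: (real \<times> real) measure)"
  and borel_measurable_snd: "snd \<in> borel_measurable (borel :: (real \<times> real) measure)"
  by (auto intro!: borel_measurable_continuous_onI continuous_intros)

context shocks begin

definition damage :: "real \<Rightarrow> 'a \<Rightarrow> real" where
  "damage t \<omega> = (\<Sum>i\<in>{1..N t \<omega>}. snd (V i \<omega>))"

definition weight :: "real \<Rightarrow> 'a \<Rightarrow> real" where
  "weight t \<omega> = exp (- (\<Sum>i\<in>{1..N t \<omega>}. fst (V i \<omega>) * (t - point N i \<omega>))) * (\<Prod>i\<in>{1..N t \<omega>}. q (point N i \<omega>))"

text \<open>The witness for \<open>is_nu\<close>. Its total mass is the mean of the weight, which is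
  at most 1, so it is finite but in general not a probability measure.\<close>

definition shock_measure :: "real \<Rightarrow> real measure" where
  "shock_measure t = distr (density M (\<lambda>\<omega>. ennreal (weight t \<omega>))) borel (damage t)"

lemma fst_V_measurable: "1 \<le> i \<Longrightarrow> (\<lambda>\<omega>. fst (V i \<omega>)) \<in> borel_measurable M"
  and snd_V_measurable: "1 \<le> i \<Longrightarrow> (\<lambda>\<omega>. snd (V i \<omega>)) \<in> borel_measurable M"
  by (rule measurable_compose[OF V_measurable borel_measurable_fst], assumption)
    (rule measurable_compose[OF V_measurable borel_measurable_snd])

lemma damage_measurable:
  assumes t: "0 \<le> t" shows "damage t \<in> borel_measurable M"
proof -
  have "(\<lambda>\<omega>. \<Sum>i\<in>{1..N t \<omega>}. snd (V i \<omega>)) \<in> borel_measurable M"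
    by (rule measurable_compose_countable[where g="N t", OF _ N_measurable[OF t]])
       (intro borel_measurable_sum snd_V_measurable, simp)
  then show ?thesis unfolding damage_def .
qed

lemma weight_measurable:
  assumes t: "0 \<le> t" shows "weight t \<in> borel_measurable M"
proof -
  let ?T = "\<lambda>i \<omega>. if i \<in> {1..N t \<omega>} then point N i \<omega> else 0"
  have "(\<lambda>\<omega>. \<Sum>i\<in>{1..N t \<omega>}. fst (V i \<omega>) * (t - ?T i \<omega>)) \<in> borel_measurable M"
    by (rule measurable_compose_countable[where g="N t", OF _ N_measurable[OF t]])
       (intro borel_measurable_sum borel_measurable_times borel_measurable_diff borel_measurable_const
          fst_V_measurable point_clip_measurable[OF t], simp)
  also have "(\<lambda>\<omega>. \<Sum>i\<in>{1..N t \<omega>}. fst (V i \<omega>) * (t - ?T i \<omega>))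
      = (\<lambda>\<omega>. \<Sum>i\<in>{1..N t \<omega>}. fst (V i \<omega>) * (t - point N i \<omega>))"
    by (intro ext sum.cong) simp_all
  finally have 1: "(\<lambda>\<omega>. \<Sum>i\<in>{1..N t \<omega>}. fst (V i \<omega>) * (t - point N i \<omega>)) \<in> borel_measurable M" .
  \<comment> \<open>\<open>q\<close> is known to be measurable only on the half-line, so it is
    replaced by its extension by zero; the arrival times are positive.\<close>
  have "(\<lambda>\<omega>. \<Prod>i\<in>{1..N t \<omega>}. q (point N i \<omega>)) \<in> borel_measurable M \<longleftrightarrow>
      (\<lambda>\<omega>. \<Prod>i\<in>{1..N t \<omega>}. indicator {0..} (point N i \<omega>) * q (point N i \<omega>)) \<in> borel_measurable M"
  proof (intro measurable_cong prod.cong refl)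
    fix \<omega> i assume "\<omega> \<in> space M" "i \<in> {1..N t \<omega>}"
    then show "q (point N i \<omega>) = indicator {0..} (point N i \<omega>) * q (point N i \<omega>)"
      using point_pos[OF _ t, of \<omega> i] by simp
  qed
  then have 2: "(\<lambda>\<omega>. \<Prod>i\<in>{1..N t \<omega>}. q (point N i \<omega>)) \<in> borel_measurable M"
    using prod_points_measurable[OF t q_measurable] by blast
  have "(\<lambda>\<omega>. exp (- (\<Sum>i\<in>{1..N t \<omega>}. fst (V i \<omega>) * (t - point N i \<omega>))) * (\<Prod>i\<in>{1..N t \<omega>}. q (point N i \<omega>))) \<in> borel_measurable M"
    by (intro borel_measurable_times borel_measurable_uminus measurable_compose[OF _ borel_measurable_exp] 1 2)
  then show ?thesis unfolding weight_def .
qed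

lemma AE_V_all_nonneg: "AE \<omega> in M. \<forall>i\<in>{1..}. 0 \<le> fst (V i \<omega>) \<and> 0 \<le> snd (V i \<omega>)"
  using AE_V_nonneg by (intro AE_ball_countable[THEN iffD2]) auto

lemma weight_nonneg:
  assumes t: "0 \<le> t" and "\<omega> \<in> space M"
  shows "0 \<le> weight t \<omega>"
  unfolding weight_def
proof (intro mult_nonneg_nonneg prod_nonneg exp_ge_zero)
  fix i assume "i \<in> {1..N t \<omega>}"
  then show "0 \<le> q (point N i \<omega>)" using point_pos[OF assms(2) t, of i] by (intro q_bounds) simp
qed

text \<open>The discount exponent has the right sign because marks are nonnegative, which is assumed
  almost surely only, and because the counted points do not exceed \<open>t\<close>.\<close>

lemma AE_weight_le_1:
  assumes t: "0 \<le> t"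
  shows "AE \<omega> in M. weight t \<omega> \<le> 1"
  using AE_V_all_nonneg AE_space
proof eventually_elim
  case (elim \<omega>)
  have "0 \<le> (\<Sum>i\<in>{1..N t \<omega>}. fst (V i \<omega>) * (t - point N i \<omega>))"
    using elim point_le[OF elim(2) t] by (intro sum_nonneg mult_nonneg_nonneg) simp_all
  then have "exp (- (\<Sum>i\<in>{1..N t \<omega>}. fst (V i \<omega>) * (t - point N i \<omega>))) \<le> 1"
    by (subst exp_le_one_iff) linarith
  moreover have "0 \<le> q (point N i \<omega>) \<and> q (point N i \<omega>) \<le> 1" if "i \<in> {1..N t \<omega>}" for i
    using point_pos[OF elim(2) t, of i] q_bounds[of "point N i \<omega>"] that by simp
  then have "(\<Prod>i\<in>{1..N t \<omega>}. q (point N i \<omega>)) \<le> 1" "0 \<le> (\<Prod>i\<in>{1..N t \<omega>}. q (point N i \<omega>))"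
    by (blast intro: prod_le_1 prod_nonneg)+
  ultimately show ?case unfolding weight_def by - (rule mult_le_one)
qed

lemma AE_damage_nonneg: "AE \<omega> in M. 0 \<le> damage t \<omega>"
  using AE_V_all_nonneg unfolding damage_def by eventually_elim (intro sum_nonneg, simp)

lemma integral_shock_measure:
  fixes f :: "real \<Rightarrow> real"
  assumes t: "0 \<le> t" and f: "f \<in> borel_measurable borel"
  shows "(\<integral>x. f x \<partial>shock_measure t) = (\<integral>\<omega>. weight t \<omega> * f (damage t \<omega>) \<partial>M)"
proof -
  have d: "damage t \<in> borel_measurable (density M (\<lambda>\<omega>. ennreal (weight t \<omega>)))"
    using damage_measurable[OF t] by simp
  have "(\<integral>x. f x \<partial>shock_measure t) = (\<integral>\<omega>. f (damage t \<omega>) \<partial>density M (\<lambda>\<omega>. ennreal (weight t \<omega>)))"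
    unfolding shock_measure_def by (rule integral_distr[OF d f])
  also have "\<dots> = (\<integral>\<omega>. weight t \<omega> *\<^sub>R f (damage t \<omega>) \<partial>M)"
    by (rule integral_density[OF measurable_compose[OF damage_measurable[OF t] f] weight_measurable[OF t] AE_I2[OF weight_nonneg[OF t]]])
  finally show ?thesis by simp
qed

lemma sets_shock_measure: "sets (shock_measure t) = sets borel"
  unfolding shock_measure_def by simp

lemma emeasure_shock_measure:
  assumes t: "0 \<le> t" and A: "A \<in> sets borel"
  shows "emeasure (shock_measure t) A = (\<integral>\<^sup>+\<omega>. ennreal (weight t \<omega>) * indicator A (damage t \<omega>) \<partial>M)"
proof -
  note [measurable] = damage_measurable[OF t] weight_measurable[OF t]
  have "emeasure (shock_measure t) A = emeasure (density M (\<lambda>\<omega>. ennreal (weight t \<omega>))) (damage t -` A \<inter> space M)"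
    unfolding shock_measure_def using A by (subst emeasure_distr) auto
  also have "\<dots> = (\<integral>\<^sup>+\<omega>. ennreal (weight t \<omega>) * indicator (damage t -` A \<inter> space M) \<omega> \<partial>M)"
    using A by (intro emeasure_density) auto
  also have "\<dots> = (\<integral>\<^sup>+\<omega>. ennreal (weight t \<omega>) * indicator A (damage t \<omega>) \<partial>M)"
    by (intro nn_integral_cong) (auto split: split_indicator)
  finally show ?thesis .
qed

lemma finite_shock_measure:
  assumes t: "0 \<le> t" shows "finite_measure (shock_measure t)"
proof
  have "space (shock_measure t) = UNIV" unfolding shock_measure_def by simp
  moreover have UNIV_borel: "UNIV \<in> sets (borel :: real measure)" by simp
  have "emeasure (shock_measure t) UNIV \<le> (\<integral>\<^sup>+\<omega>. 1 \<partial>M)"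
    unfolding emeasure_shock_measure[OF t UNIV_borel]
    using AE_weight_le_1[OF t] by (intro nn_integral_mono_AE) (auto elim!: eventually_mono)
  ultimately show "emeasure (shock_measure t) (space (shock_measure t)) \<noteq> \<infinity>"
    using emeasure_space_1 by (auto simp: top_unique)
qed

lemma shock_measure_neg:
  assumes t: "0 \<le> t" shows "emeasure (shock_measure t) {..<0} = 0"
proof -
  have "(\<integral>\<^sup>+\<omega>. ennreal (weight t \<omega>) * indicator {..<0} (damage t \<omega>) \<partial>M) = (\<integral>\<^sup>+\<omega>. 0 \<partial>M)"
    using AE_damage_nonneg[of t] by (intro nn_integral_cong_AE) (auto elim!: eventually_mono)
  then show ?thesis using t by (simp add: emeasure_shock_measure)
qed

section \<open>The convolution form of \<open>shock_phi\<close>\<close>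

lemma cdfG_measurable: "0 \<le> t \<Longrightarrow> cdfG M G t \<in> borel_measurable borel"
  and cdfG_bounds: "0 \<le> t \<Longrightarrow> 0 \<le> cdfG M G t x" "0 \<le> t \<Longrightarrow> cdfG M G t x \<le> 1"
  and cdfG_neg: "0 \<le> t \<Longrightarrow> x < 0 \<Longrightarrow> cdfG M G t x = 0"
proof -
  assume t: "0 \<le> t"
  interpret GD: prob_space "distr M borel (G t)" using G_measurable[OF t] by (rule prob_space_distr)
  interpret GF: finite_borel_measure "distr M borel (G t)" by unfold_locales simp
  have "mono (cdfG M G t)" unfolding cdfG_def by (intro monoI GF.cdf_nondecreasing)
  then show "cdfG M G t \<in> borel_measurable borel" by (rule borel_measurable_mono)
  show "0 \<le> cdfG M G t x" "cdfG M G t x \<le> 1"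
    unfolding cdfG_def cdf_def using GD.prob_le_1 by simp_all
  assume x: "x < 0"
  have "G t -` {..x} \<inter> space M = {}" using G_nonneg[OF t] x by force
  then show "cdfG M G t x = 0"
    unfolding cdfG_def cdf_def using G_measurable[OF t] by (simp add: measure_distr)
qed

lemma shock_phi_eq:
  assumes t: "0 \<le> t"
  shows "shock_phi M q N V G t L = (\<integral>x. cdfG M G t (L - x) \<partial>shock_measure t)"
proof -
  have "(\<lambda>x. cdfG M G t (L - x)) \<in> borel_measurable borel"
    by (rule measurable_compose[OF _ cdfG_measurable[OF t]]) simp
  from integral_shock_measure[OF t this] show ?thesis
    unfolding shock_phi_def damage_def weight_def by (simp add: mult_ac)
qed

section \<open>The Laplace transform of the discounted damage law\<close>

lemma laplace2_bounds:
  assumes "0 \<le> u" "0 \<le> s"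
  shows "integrable \<mu> (\<lambda>v. exp (- u * fst v - s * snd v))" "0 \<le> laplace2 \<mu> u s" "laplace2 \<mu> u s \<le> 1"
proof -
  interpret mu: prob_space \<mu> by (rule prob_space_mu)
  note [measurable_cong] = sets_mu[unfolded borel_prod[symmetric]]
  have ae: "AE v in \<mu>. exp (- u * fst v - s * snd v) \<le> 1"
    using AE_mu_nonneg
  proof eventually_elim
    case (elim v)
    then have "0 \<le> u * fst v" "0 \<le> s * snd v" using assms by simp_all
    then show ?case by simp
  qed
  show i: "integrable \<mu> (\<lambda>v. exp (- u * fst v - s * snd v))"
    using ae by (intro mu.integrable_const_bound[where B=1]) auto
  show "0 \<le> laplace2 \<mu> u s" unfolding laplace2_def by (intro integral_nonneg_AE) simp
  have "laplace2 \<mu> u s \<le> (\<integral>v. 1 \<partial>\<mu>)"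
    unfolding laplace2_def using i ae by (intro integral_mono_AE) auto
  then show "laplace2 \<mu> u s \<le> 1" by (simp add: mu.prob_space)
qed

lemma laplace2_measurable: "(\<lambda>w. laplace2 \<mu> (t - w) s) \<in> borel_measurable borel"
proof -
  interpret mu: prob_space \<mu> by (rule prob_space_mu)
  note [measurable_cong] = sets_mu[unfolded borel_prod[symmetric]]
  show ?thesis unfolding laplace2_def by measurable
qed

lemma laplace_shock_measure:
  assumes t: "0 \<le> t" and s: "0 \<le> s"
  shows "laplace_meas (shock_measure t) s
    = exp (- cum_int lam t + (LINT w:{0..t}|lborel. q w * lam w * laplace2 \<mu> (t - w) s))"
proof -
  interpret mu: prob_space \<mu> by (rule prob_space_mu)
  note [measurable_cong] = sets_mu[unfolded borel_prod[symmetric]]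
  \<comment> \<open>Extension by zero makes \<open>q\<close> Borel with values in [0,1] on the whole
    line, as the generating functional demands.\<close>
  define q0 where "q0 x = indicator {0..} x * q x" for x
  have [measurable]: "q0 \<in> borel_measurable borel" using q_measurable unfolding q0_def[abs_def] .
  note [measurable] = laplace2_measurable[of t s]
  have q0: "0 \<le> q0 x" "q0 x \<le> 1" for x using q_bounds[of x] unfolding q0_def by (auto split: split_indicator)
  define r where "r w v = q0 w * exp (- (t - w) * fst v - s * snd v)" for w and v :: "real \<times> real"
  \<comment> \<open>The cut-off at \<open>t\<close> is needed for \<open>0 \<le> h \<le> 1\<close>:
    beyond \<open>t\<close> the first argument of \<open>laplace2\<close> is negative and its value
    is no longer bounded by 1. Both the points and the intensity live on \<open>{0..t}\<close>, so
    nothing is lost.\<close>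
  define h where "h w = indicator {0..t} w * (q0 w * laplace2 \<mu> (t - w) s)" for w
  have h_meas[measurable]: "h \<in> borel_measurable borel" unfolding h_def by measurable
  have h01: "0 \<le> h w" "h w \<le> 1" for w
    using laplace2_bounds(2,3)[of "t - w" s] q0[of w] s
    unfolding h_def by (auto split: split_indicator intro: mult_le_one)
  have r0: "0 \<le> r w v" for w v using q0 unfolding r_def by simp
  have prod_r: "weight t \<omega> * exp (- damage t \<omega> * s) = (\<Prod>i\<in>{1..N t \<omega>}. r (point N i \<omega>) (V i \<omega>))"
    if \<omega>: "\<omega> \<in> space M" for \<omega>
  proof -
    have "(\<Prod>i\<in>{1..N t \<omega>}. r (point N i \<omega>) (V i \<omega>))
        = (\<Prod>i\<in>{1..N t \<omega>}. q (point N i \<omega>) * exp (- (fst (V i \<omega>) * (t - point N i \<omega>)) - s * snd (V i \<omega>)))"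
    proof (rule prod.cong[OF refl])
      fix i assume "i \<in> {1..N t \<omega>}"
      then have "0 < point N i \<omega>" using point_pos[OF \<omega> t, of i] by simp
      then show "r (point N i \<omega>) (V i \<omega>) = q (point N i \<omega>) * exp (- (fst (V i \<omega>) * (t - point N i \<omega>)) - s * snd (V i \<omega>))"
        unfolding r_def q0_def by (simp add: algebra_simps)
    qed
    also have "\<dots> = (\<Prod>i\<in>{1..N t \<omega>}. q (point N i \<omega>)) *
        exp (\<Sum>i\<in>{1..N t \<omega>}. - (fst (V i \<omega>) * (t - point N i \<omega>)) - s * snd (V i \<omega>))"
      by (simp add: prod.distrib exp_sum)
    also have "(\<Sum>i\<in>{1..N t \<omega>}. - (fst (V i \<omega>) * (t - point N i \<omega>)) - s * snd (V i \<omega>))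
        = - (\<Sum>i\<in>{1..N t \<omega>}. fst (V i \<omega>) * (t - point N i \<omega>)) + - damage t \<omega> * s"
      unfolding damage_def by (simp add: sum_subtractf sum_negf sum_distrib_left mult.commute)
    finally show ?thesis unfolding weight_def exp_add by (simp only: mult_ac)
  qed
  have avg: "(\<integral>\<^sup>+v. ennreal (r w v) \<partial>\<mu>) = ennreal (h w)" if w: "w \<in> {0..t}" for w
  proof -
    have "(\<integral>\<^sup>+v. ennreal (r w v) \<partial>\<mu>) = ennreal (\<integral>v. r w v \<partial>\<mu>)"
      using w s r0 unfolding r_def by (intro nn_integral_eq_integral integrable_mult_right laplace2_bounds) auto
    also have "(\<integral>v. r w v \<partial>\<mu>) = q0 w * laplace2 \<mu> (t - w) s"
      unfolding r_def laplace2_def by simp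
    finally show ?thesis using w unfolding h_def by simp
  qed
  \<comment> \<open>The chain passes to \<open>ennreal\<close> because the averaging over marks is
    stated for nonnegative integrals; nonnegativity of both sides brings it back to the reals at the
    end.\<close>
  have "ennreal (laplace_meas (shock_measure t) s) = ennreal (\<integral>\<omega>. weight t \<omega> * exp (- damage t \<omega> * s) \<partial>M)"
    unfolding laplace_meas_def using integral_shock_measure[OF t, of "\<lambda>x. exp (- x * s)"] by simp
  also have "\<dots> = (\<integral>\<^sup>+\<omega>. ennreal (weight t \<omega> * exp (- damage t \<omega> * s)) \<partial>M)"
  proof (rule nn_integral_eq_integral[symmetric])
    note [measurable] = damage_measurable[OF t] weight_measurable[OF t]
    show "integrable M (\<lambda>\<omega>. weight t \<omega> * exp (- damage t \<omega> * s))"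
    proof (rule integrable_const_bound[where B=1])
      show "AE \<omega> in M. norm (weight t \<omega> * exp (- damage t \<omega> * s)) \<le> 1"
        using AE_weight_le_1[OF t] AE_damage_nonneg[of t] AE_space
      proof eventually_elim
        case (elim \<omega>)
        have "exp (- damage t \<omega> * s) \<le> 1" using elim s by simp
        then show ?case using elim weight_nonneg[OF t elim(3)]
          by (simp only: real_norm_def abs_mult abs_exp_cancel abs_of_nonneg) (intro mult_le_one, auto)
      qed
    qed measurable
    show "AE \<omega> in M. 0 \<le> weight t \<omega> * exp (- damage t \<omega> * s)"
      using weight_nonneg[OF t] by (intro AE_I2) simp
  qed
  also have "\<dots> = (\<integral>\<^sup>+\<omega>. (\<Prod>i\<in>{1..N t \<omega>}. ennreal (r (point N i \<omega>) (V i \<omega>))) \<partial>M)"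
    by (intro nn_integral_cong) (simp only: prod_r prod_ennreal[OF r0])
  also have "\<dots> = (\<integral>\<^sup>+\<omega>. (\<Prod>i\<in>{1..N t \<omega>}. \<integral>\<^sup>+v. ennreal (r (point N i \<omega>) v) \<partial>\<mu>) \<partial>M)"
  proof -
    have "(\<lambda>p. ennreal (r (fst p) (snd p))) \<in> borel_measurable (borel \<Otimes>\<^sub>M (borel \<Otimes>\<^sub>M borel))"
      unfolding r_def by measurable
    then have "(\<lambda>p. ennreal (r (fst p) (snd p))) \<in> borel_measurable borel" by (simp add: borel_prod)
    from nn_integral_mark_average[OF t this] show ?thesis by simp
  qed
  also have "\<dots> = (\<integral>\<^sup>+\<omega>. ennreal (\<Prod>i\<in>{1..N t \<omega>}. h (point N i \<omega>)) \<partial>M)"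
  proof (intro nn_integral_cong)
    fix \<omega> assume \<omega>: "\<omega> \<in> space M"
    have "(\<Prod>i\<in>{1..N t \<omega>}. \<integral>\<^sup>+v. ennreal (r (point N i \<omega>) v) \<partial>\<mu>) = (\<Prod>i\<in>{1..N t \<omega>}. ennreal (h (point N i \<omega>)))"
    proof (intro prod.cong refl avg)
      fix i assume "i \<in> {1..N t \<omega>}"
      then show "point N i \<omega> \<in> {0..t}" using point_pos[OF \<omega> t, of i] point_le[OF \<omega> t, of i] by simp
    qed
    then show "(\<Prod>i\<in>{1..N t \<omega>}. \<integral>\<^sup>+v. ennreal (r (point N i \<omega>) v) \<partial>\<mu>) = ennreal (\<Prod>i\<in>{1..N t \<omega>}. h (point N i \<omega>))"
      by (simp only: prod_ennreal[OF h01(1)])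
  qed
  also have "\<dots> = ennreal (\<integral>\<omega>. (\<Prod>i\<in>{1..N t \<omega>}. h (point N i \<omega>)) \<partial>M)"
  proof (intro nn_integral_eq_integral integrable_const_bound[where B=1] AE_I2)
    show "norm (\<Prod>i\<in>{1..N t \<omega>}. h (point N i \<omega>)) \<le> 1" for \<omega>
      unfolding real_norm_def abs_prod using h01 by (intro prod_le_1) simp
    show "0 \<le> (\<Prod>i\<in>{1..N t \<omega>}. h (point N i \<omega>))" for \<omega> by (intro prod_nonneg h01)
    show "(\<lambda>\<omega>. \<Prod>i\<in>{1..N t \<omega>}. h (point N i \<omega>)) \<in> borel_measurable M" by (rule prod_points_measurable[OF t h_meas])
  qed
  also have "(\<integral>\<omega>. (\<Prod>i\<in>{1..N t \<omega>}. h (point N i \<omega>)) \<partial>M) = exp (- (\<integral>w. (1 - h w) * (indicator {0..t} w * lam w) \<partial>lborel))"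
    by (rule probability_generating_functional[OF t h_meas h01])
  \<comment> \<open>The constant 1 contributes the cumulated intensity, and on \<open>{0..t}\<close>
    the function \<open>h\<close> is \<open>q\<close> times the transform of the marks.\<close>
  also have "- (\<integral>w. (1 - h w) * (indicator {0..t} w * lam w) \<partial>lborel)
      = - cum_int lam t + (LINT w:{0..t}|lborel. q w * lam w * laplace2 \<mu> (t - w) s)"
  proof -
    note [measurable] = lam_indicator_measurable[OF t]
    have i: "integrable lborel (\<lambda>w. h w * (indicator {0..t} w * lam w))"
    proof (rule Bochner_Integration.integrable_bound[OF lam_indicator_integrable[OF t]])
      show "AE w in lborel. norm (h w * (indicator {0..t} w * lam w)) \<le> norm (indicator {0..t} w * lam w)"
        using h01 by (intro AE_I2) (simp add: abs_mult mult_left_le_one_le)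
    qed measurable
    have "(\<integral>w. (1 - h w) * (indicator {0..t} w * lam w) \<partial>lborel)
        = (\<integral>w. indicator {0..t} w * lam w - h w * (indicator {0..t} w * lam w) \<partial>lborel)"
      by (simp add: algebra_simps)
    also have "\<dots> = (\<integral>w. indicator {0..t} w * lam w \<partial>lborel) - (\<integral>w. h w * (indicator {0..t} w * lam w) \<partial>lborel)"
      by (rule Bochner_Integration.integral_diff[OF lam_indicator_integrable[OF t] i])
    also have "(\<integral>w. h w * (indicator {0..t} w * lam w) \<partial>lborel)
        = (LINT w:{0..t}|lborel. q w * lam w * laplace2 \<mu> (t - w) s)"
      unfolding set_lebesgue_integral_def h_def q0_def
      by (intro Bochner_Integration.integral_cong refl) (auto split: split_indicator)
    finally show ?thesis unfolding cum_int_def set_lebesgue_integral_def by simp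
  qed
  finally have "ennreal (laplace_meas (shock_measure t) s)
      = ennreal (exp (- cum_int lam t + (LINT w:{0..t}|lborel. q w * lam w * laplace2 \<mu> (t - w) s)))" .
  moreover have "0 \<le> laplace_meas (shock_measure t) s"
    unfolding laplace_meas_def by (intro integral_nonneg_AE) simp
  ultimately show ?thesis by (simp only: ennreal_inj exp_ge_zero)
qed

lemma is_nu_shock_measure: "0 \<le> t \<Longrightarrow> is_nu lam q \<mu> t (shock_measure t)"
  unfolding is_nu_def using sets_shock_measure finite_shock_measure shock_measure_neg laplace_shock_measure by blast

lemma is_nu_unique:
  assumes t: "0 \<le> t" and \<nu>: "is_nu lam q \<mu> t \<nu>"
  shows "\<nu> = shock_measure t"
proof (rule laplace_transform_unique)
  note s = is_nu_shock_measure[OF t]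
  show "sets \<nu> = sets borel" "sets (shock_measure t) = sets borel" "finite_measure \<nu>" "finite_measure (shock_measure t)"
    "emeasure \<nu> {..<0} = 0" "emeasure (shock_measure t) {..<0} = 0"
    using \<nu> s unfolding is_nu_def by blast+
  fix n :: nat
  have "laplace_meas \<nu> (real n) = laplace_meas (shock_measure t) (real n)"
    using \<nu> s of_nat_0_le_iff[of n] unfolding is_nu_def by metis
  then show "(\<integral>x. exp (- x * real n) \<partial>\<nu>) = (\<integral>x. exp (- x * real n) \<partial>shock_measure t)"
    unfolding laplace_meas_def .
qed

text \<open>Independence concerns \<open>V 1\<close> on \<open>M\<close>, so the transforms of
  \<open>\<mu>\<close> and of its marginals are pulled back along \<open>V 1\<close>, where the
  expectation of a product of exponentials factorises.\<close>

lemma laplace2_product: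
  assumes indep: "indep_var borel (\<lambda>\<omega>. fst (V 1 \<omega>)) borel (\<lambda>\<omega>. snd (V 1 \<omega>))"
    and u: "0 \<le> u" and s: "0 \<le> s"
  shows "laplace2 \<mu> u s = laplace_meas (distr \<mu> borel fst) u * laplace_meas (distr \<mu> borel snd) s"
proof -
  note V1 = V_measurable[OF order_refl]
  note [measurable] = fst_V_measurable[OF order_refl] snd_V_measurable[OF order_refl] V1 borel_measurable_fst borel_measurable_snd
  have bnd: "integrable M (\<lambda>\<omega>. exp (- u * fst (V 1 \<omega>)))" "integrable M (\<lambda>\<omega>. exp (- s * snd (V 1 \<omega>)))"
  proof (rule_tac [!] integrable_const_bound[where B=1])
    show "AE \<omega> in M. norm (exp (- u * fst (V 1 \<omega>))) \<le> 1" "AE \<omega> in M. norm (exp (- s * snd (V 1 \<omega>))) \<le> 1"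
      using AE_V_nonneg[OF order_refl] by (eventually_elim, use u s in simp)+
  qed measurable
  have e: "indep_var borel ((\<lambda>x. exp (- u * x)) \<circ> (\<lambda>\<omega>. fst (V 1 \<omega>))) borel ((\<lambda>x. exp (- s * x)) \<circ> (\<lambda>\<omega>. snd (V 1 \<omega>)))"
    by (rule indep_var_compose[OF indep]) measurable
  have marginal: "laplace_meas (distr \<mu> borel f) r = (\<integral>\<omega>. exp (- r * f (V 1 \<omega>)) \<partial>M)"
    if f: "f \<in> borel_measurable borel" for f r
    unfolding laplace_meas_def distr_V[OF order_refl, symmetric] distr_distr[OF f V1] o_def
    by (subst integral_distr[OF measurable_compose[OF V1 f]]) (simp_all add: mult.commute)
  have "laplace2 \<mu> u s = (\<integral>\<omega>. exp (- u * fst (V 1 \<omega>) - s * snd (V 1 \<omega>)) \<partial>M)"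
    unfolding laplace2_def distr_V[OF order_refl, symmetric] by (rule integral_distr[OF V1]) measurable
  also have "\<dots> = (\<integral>\<omega>. exp (- u * fst (V 1 \<omega>)) * exp (- s * snd (V 1 \<omega>)) \<partial>M)"
    by (simp add: exp_add[symmetric])
  also have "\<dots> = (\<integral>\<omega>. exp (- u * fst (V 1 \<omega>)) \<partial>M) * (\<integral>\<omega>. exp (- s * snd (V 1 \<omega>)) \<partial>M)"
    by (rule indep_var_lebesgue_integral[OF e[unfolded o_def] bnd])
  finally show ?thesis unfolding marginal[OF borel_measurable_fst] marginal[OF borel_measurable_snd] .
qed

end

theorem theorem1:
  fixes M :: "'a measure" and lam q :: "real \<Rightarrow> real" and N :: "real \<Rightarrow> 'a \<Rightarrow> nat"
    and V :: "nat \<Rightarrow> 'a \<Rightarrow> real \<times> real" and \<mu> :: "(real \<times> real) measure"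
    and G :: "real \<Rightarrow> 'a \<Rightarrow> real" and t :: real
  assumes model: "shock_model M lam q N V \<mu> G"
    and t: "0 \<le> t"
  shows "(\<exists>\<nu>. is_nu lam q \<mu> t \<nu>)
    \<and> (\<forall>\<nu>. is_nu lam q \<mu> t \<nu> \<longrightarrow>
          (\<forall>s\<ge>0. laplace_fun (shock_phi M q N V G t) s
                   = laplace_fun (cdfG M G t) s * ennreal (laplace_meas \<nu> s))
        \<and> (\<forall>L\<ge>0. shock_phi M q N V G t L = (\<integral>x. cdfG M G t (L - x) \<partial>\<nu>))
        \<and> (prob_space.indep_var M borel (\<lambda>\<omega>. fst (V 1 \<omega>)) borel (\<lambda>\<omega>. snd (V 1 \<omega>)) \<longrightarrow>
             (\<forall>s\<ge>0. laplace_meas \<nu> s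
                = exp (- cum_int lam t
                       + (LINT w:{0..t}|lborel. laplace_meas (distr \<mu> borel fst) (t - w) * q w * lam w)
                         * laplace_meas (distr \<mu> borel snd) s))))"
proof -
  interpret shocks M lam q N V \<mu> G using model by unfold_locales
  show ?thesis
  proof (intro conjI allI impI)
    show "\<exists>\<nu>. is_nu lam q \<mu> t \<nu>" using is_nu_shock_measure[OF t] by blast
    fix \<nu> assume \<nu>: "is_nu lam q \<mu> t \<nu>"
    \<comment> \<open>An equality of functions, valid for every real argument, so both the transform
      and the convolution identity follow by rewriting.\<close>
    have phi: "shock_phi M q N V G t = (\<lambda>L. \<integral>x. cdfG M G t (L - x) \<partial>\<nu>)"
      unfolding is_nu_unique[OF t \<nu>] using shock_phi_eq[OF t] by blast
    show "shock_phi M q N V G t L = (\<integral>x. cdfG M G t (L - x) \<partial>\<nu>)" for L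
      unfolding phi ..
    show "laplace_fun (shock_phi M q N V G t) s = laplace_fun (cdfG M G t) s * ennreal (laplace_meas \<nu> s)"
      if s: "0 \<le> s" for s
      unfolding phi using \<nu> unfolding is_nu_def
      by (intro laplace_fun_convolution cdfG_measurable[OF t] cdfG_bounds[OF t] cdfG_neg[OF t] s) blast+
    assume indep: "indep_var borel (\<lambda>\<omega>. fst (V 1 \<omega>)) borel (\<lambda>\<omega>. snd (V 1 \<omega>))"
    fix s :: real assume s: "0 \<le> s"
    \<comment> \<open>On \<open>{0..t}\<close> the argument \<open>t - w\<close> is nonnegative, so
      the factorisation applies; the factor depending on \<open>s\<close> alone can then leave the
      integral.\<close>
    have "(LINT w:{0..t}|lborel. q w * lam w * laplace2 \<mu> (t - w) s)
        = (LINT w:{0..t}|lborel. (laplace_meas (distr \<mu> borel fst) (t - w) * q w * lam w) * laplace_meas (distr \<mu> borel snd) s)"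
      by (rule set_lebesgue_integral_cong) (auto simp: laplace2_product[OF indep _ s])
    then show "laplace_meas \<nu> s = exp (- cum_int lam t
        + (LINT w:{0..t}|lborel. laplace_meas (distr \<mu> borel fst) (t - w) * q w * lam w) * laplace_meas (distr \<mu> borel snd) s)"
      using \<nu> s unfolding is_nu_def by simp
  qed
qed

end
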